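(* For $i=1,2$ let $A_i,B_i$ and $C$ be cones in $\mathcal{AC}$ and let $n>0$ be an integer. (1) If $f:A_1\twoheadrightarrow B_1$ has dense image, then $\mathrm{Sym}^n(f):\mathrm{Sym}^n(A_1)\twoheadrightarrow\mathrm{Sym}^n(B_1)$ has dense image, and $f^*:\mathrm{Hom}_{\mathcal{AC}}(B_1,C)\hookrightarrow\mathrm{Hom}_{\mathcal{AC}}(A_1,C)$ (pre-composition with $f$) and $\hat{f}^*:\mathrm{Hom}_{\mathcal{AC}}(C,B_1^* )\hookrightarrow\mathrm{Hom}_{\mathcal{AC}}(C,A_1^* )$ (post-composition with the transpose $B_1^*\to A_1^*$ of $f$) are strongly injective. If moreover $g:A_2\twoheadrightarrow B_2$ has dense image, then $f\otimes g:A_1\otimes A_2\twoheadrightarrow B_1\otimes B_2$ has dense image. (2) If $h:A_1\hookrightarrow B_1$ is strongly injective, then $\hat h:\mathrm{Hom}_{\mathcal{AC}}(C,A_1)\hookrightarrow\mathrm{Hom}_{\mathcal{AC}}(C,B_1)$ (post-composition with $h$), $h^{**}:\mathrm{Hom}_{\mathcal{AC}}(A_1^*,C)\hookrightarrow\mathrm{Hom}_{\mathcal{AC}}(B_1^*,C)$ (pre-composition with the transpose $h^*:B_1^*\to A_1^*$) and $\mathrm{Sym}^n(h):\mathrm{Sym}^n(A_1^* )^*\hookrightarrow\mathrm{Sym}^n(B_1^* )^*$ are strongly injective, and there are inclusions $$\mathrm{Sym}^n(A_1)\subseteq\mathrm{Sym}^n(h)^{-1}(\mathrm{Sym}^n(B_1))\subseteq\mathrm{Sym}^n(A_1^*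 )^*.$$ If moreover $t:A_2\hookrightarrow B_2$ is strongly injective, then $h\otimes t:(A_1^*\otimes A_2^* )^*\hookrightarrow(B_1^*\otimes B_2^* )^*$ is strongly injective and there are inclusions $$A_1\otimes A_2\subseteq(h\otimes t)^{-1}(B_1\otimes B_2)\subseteq(A_1^*\otimes A_2^* )^*.$$
   Context: All vector spaces are real and finite-dimensional. Category $\mathcal{AC}$: objects are pairs $(C,LC)$ with $C\subseteq LC$ a closed, full-dimensional, pointed convex cone (pointed: some linear functional is $\ge 0$ on $C$ and vanishes on $C$ only at $0$); morphisms $\mathrm{Hom}_{\mathcal{AC}}(C_1,C_2)$ are the linear maps $f:LC_1\to LC_2$ with $f(C_1)\subseteq C_2$, and this set is regarded as a cone in $\mathrm{Hom}(LC_1,LC_2)$. The dual of $C$ is $C^*=\{\phi\in(LC)^*:\phi\ge0\text{ on }C\}$, and the transpose of $f\in\mathrm{Hom}_{\mathcal{AC}}(C_1,C_2)$ is a morphism $C_2^*\to C_1^*$. $C_1\otimes C_2:=\mathrm{Cone}\{c_1\otimes c_2:c_i\in C_i\}\subseteq LC_1\otimes LC_2$; $\mathrm{Sym}^n(C):=\mathrm{Cone}\{v_1\cdots v_n:v_i\in C\}\subseteq\mathrm{Sym}^n(LC)$. All these are objects of $\mathcal{AC}$. A morphism $f\in\mathrm{Hom}_{\mathcal{AC}}(C,D)$ is strongly injective, written $f:C\hookrightarrow D$, if the linear map $f:LC\to LD$ is injective and $f^{-1}(D)=C$. It has dense image, written $f:C\twoheadrightarrow D$, if $\overline{f(C)}=D$.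 Using the canonical identifications $(V_1^*\otimes V_2^* )^*\cong V_1\otimes V_2$ and $\mathrm{Sym}^n(V^* )^*\cong\mathrm{Sym}^n(V)$ (the latter by the pairing of $v_1\cdots v_n$ with $\phi_1\cdots\phi_n$ given by $\frac1{n!}\sum_{\sigma\in S_n}\prod_i\phi_i(v_{\sigma(i)})$), the cones $(A_1^*\otimes A_2^* )^*$ and $\mathrm{Sym}^n(A_1^* )^*$ are regarded as cones in $LA_1\otimes LA_2$ and $\mathrm{Sym}^n(LA_1)$ (similarly for $B_i$), and $h\otimes t$, $\mathrm{Sym}^n(h)$ are the corresponding linear maps. *)

theory Defs
  imports "HOL-Analysis.Analysis"
begin

text \<open>
  A finite-dimensional real vector space is rendered as a real normed type possessing a finite
  spanning set (zero-dimensional types included).  All norms on such a space induce the same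
  topology and all linear maps out of it are bounded, so the norm carries no information and
  \<^typ>\<open>'a \<Rightarrow>\<^sub>L 'b\<close> is the space of all linear maps.
\<close>

section \<open>The category of cones\<close>

text \<open>The ambient space \<open>LC\<close> is the whole type.\<close>

definition ac_object :: "'a::real_normed_vector set \<Rightarrow> bool" where
  "ac_object C \<longleftrightarrow>
     (\<exists>B :: 'a set. finite B \<and> span B = UNIV) \<and>
     convex_cone C \<and> closed C \<and> span C = UNIV \<and>
     (\<exists>\<phi> :: 'a \<Rightarrow> real. linear \<phi> \<and> (\<forall>x\<in>C. 0 \<le> \<phi> x \<and> (\<phi> x = 0 \<longrightarrow> x = 0)))"

definition ac_hom ::
    "'a::real_normed_vector set \<Rightarrow> 'b::real_normed_vector set \<Rightarrow> ('a \<Rightarrow>\<^sub>L 'b) set" where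
  "ac_hom C D = {f. blinfun_apply f ` C \<subseteq> D}"

definition strongly_injective ::
    "'a::real_normed_vector set \<Rightarrow> 'b::real_normed_vector set \<Rightarrow> ('a \<Rightarrow>\<^sub>L 'b) \<Rightarrow> bool" where
  "strongly_injective C D f \<longleftrightarrow>
     f \<in> ac_hom C D \<and> inj (blinfun_apply f) \<and> blinfun_apply f -` D = C"

definition dense_image ::
    "'a::real_normed_vector set \<Rightarrow> 'b::real_normed_vector set \<Rightarrow> ('a \<Rightarrow>\<^sub>L 'b) \<Rightarrow> bool" where
  "dense_image C D f \<longleftrightarrow> f \<in> ac_hom C D \<and> closure (blinfun_apply f ` C) = D"

definition dual_cone :: "'a::real_normed_vector set \<Rightarrow> ('a \<Rightarrow>\<^sub>L real) set" where
  "dual_cone C = {\<phi>. \<forall>x\<in>C. 0 \<le> blinfun_apply \<phi> x}"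

definition precomp ::
    "('a::real_normed_vector \<Rightarrow>\<^sub>L 'b::real_normed_vector) \<Rightarrow>
     ('b \<Rightarrow>\<^sub>L 'c::real_normed_vector) \<Rightarrow>\<^sub>L ('a \<Rightarrow>\<^sub>L 'c)" where
  "precomp f = Blinfun (\<lambda>g. g o\<^sub>L f)"

definition postcomp ::
    "('a::real_normed_vector \<Rightarrow>\<^sub>L 'b::real_normed_vector) \<Rightarrow>
     ('c::real_normed_vector \<Rightarrow>\<^sub>L 'a) \<Rightarrow>\<^sub>L ('c \<Rightarrow>\<^sub>L 'b)" where
  "postcomp f = Blinfun (\<lambda>g. f o\<^sub>L g)"

abbreviation transpose_map ::
    "('a::real_normed_vector \<Rightarrow>\<^sub>L 'b::real_normed_vector) \<Rightarrow> ('b \<Rightarrow>\<^sub>L real) \<Rightarrow>\<^sub>L ('a \<Rightarrow>\<^sub>L real)" where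
  "transpose_map f \<equiv> precomp f"

lemma precomp_apply [simp]: "blinfun_apply (precomp f) g = g o\<^sub>L f"
  unfolding precomp_def
  by (simp add: bounded_linear_Blinfun_apply
      bounded_bilinear.bounded_linear_left[OF bounded_bilinear_blinfun_compose])

lemma postcomp_apply [simp]: "blinfun_apply (postcomp f) g = f o\<^sub>L g"
  unfolding postcomp_def
  by (simp add: bounded_linear_Blinfun_apply
      bounded_bilinear.bounded_linear_right[OF bounded_bilinear_blinfun_compose])

section \<open>Tensor products\<close>

text \<open>
  The tensor product \<open>V \<otimes> W\<close> of finite-dimensional spaces is realised as the dual of the space of
  bilinear forms on \<open>V \<times> W\<close>, with \<open>v \<otimes> w\<close> the evaluation at \<open>(v, w)\<close> (the definition in Halmos,
  Finite-Dimensional Vector Spaces).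
\<close>

type_synonym ('a, 'b) tensor = "('a \<Rightarrow>\<^sub>L 'b \<Rightarrow>\<^sub>L real) \<Rightarrow>\<^sub>L real"

definition tensor_prod ::
    "'a::real_normed_vector \<Rightarrow> 'b::real_normed_vector \<Rightarrow> ('a, 'b) tensor" where
  "tensor_prod v w = Blinfun (\<lambda>b. blinfun_apply (blinfun_apply b v) w)"

lemma tensor_prod_apply [simp]:
  "blinfun_apply (tensor_prod v w) b = blinfun_apply (blinfun_apply b v) w"
  unfolding tensor_prod_def
  by (subst bounded_linear_Blinfun_apply)
     (auto intro: bounded_linear_compose[OF blinfun.bounded_linear_left blinfun.bounded_linear_left])

definition tensor_cone ::
    "'a::real_normed_vector set \<Rightarrow> 'b::real_normed_vector set \<Rightarrow> ('a, 'b) tensor set" where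
  "tensor_cone C D = convex_cone hull {tensor_prod c d | c d. c \<in> C \<and> d \<in> D}"

text \<open>\<open>f \<otimes> g\<close> is the transpose of the map \<open>b \<mapsto> (\<lambda>x y. b (f x) (g y))\<close> on bilinear forms.\<close>

definition tensor_map ::
    "('a::real_normed_vector \<Rightarrow>\<^sub>L 'c::real_normed_vector) \<Rightarrow>
     ('b::real_normed_vector \<Rightarrow>\<^sub>L 'd::real_normed_vector) \<Rightarrow>
     ('a, 'b) tensor \<Rightarrow>\<^sub>L ('c, 'd) tensor" where
  "tensor_map f g = transpose_map (postcomp (transpose_map g) o\<^sub>L precomp f)"

lemma tensor_map_tensor_prod:
  "blinfun_apply (tensor_map f g) (tensor_prod v w) =
     tensor_prod (blinfun_apply f v) (blinfun_apply g w)"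
  by (rule blinfun_eqI) (simp add: tensor_map_def)

definition bilinear_form ::
    "('a::real_normed_vector \<Rightarrow> 'b::real_normed_vector \<Rightarrow> real) \<Rightarrow> 'a \<Rightarrow>\<^sub>L 'b \<Rightarrow>\<^sub>L real" where
  "bilinear_form b = Blinfun (\<lambda>v. Blinfun (b v))"

lemma bilinear_form_apply:
  assumes "bounded_bilinear b"
  shows "blinfun_apply (blinfun_apply (bilinear_form b) v) w = b v w"
proof -
  interpret bounded_bilinear b by fact
  have "bilinear_form b = Blinfun prod_right"
    by (simp add: bilinear_form_def prod_right_def map_fun_def o_def)
  then show ?thesis
    by (simp add: bounded_linear_Blinfun_apply bounded_linear_prod_right prod_right.rep_eq)
qed

text \<open>
  The canonical map \<open>V \<otimes> W \<rightarrow> (V\<^sup>* \<otimes> W\<^sup>*)\<^sup>*\<close>, determined by pairing \<open>v \<otimes> w\<close> with \<open>\<phi> \<otimes> \<psi>\<close> to \<open>\<phi> v \<cdot> \<psi> w\<close>.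
\<close>

definition covector_prod ::
    "('a::real_normed_vector \<Rightarrow>\<^sub>L real) \<Rightarrow> ('b::real_normed_vector \<Rightarrow>\<^sub>L real) \<Rightarrow>
     'a \<Rightarrow>\<^sub>L 'b \<Rightarrow>\<^sub>L real" where
  "covector_prod \<phi> \<psi> = bilinear_form (\<lambda>v w. blinfun_apply \<phi> v * blinfun_apply \<psi> w)"

definition tensor_ident ::
    "('a::real_normed_vector, 'b::real_normed_vector) tensor \<Rightarrow>
     ('a \<Rightarrow>\<^sub>L real, 'b \<Rightarrow>\<^sub>L real) tensor \<Rightarrow>\<^sub>L real" where
  "tensor_ident x =
     Blinfun (\<lambda>y. blinfun_apply y (bilinear_form (\<lambda>\<phi> \<psi>. blinfun_apply x (covector_prod \<phi> \<psi>))))"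

lemma covector_prod_apply [simp]:
  "blinfun_apply (blinfun_apply (covector_prod \<phi> \<psi>) v) w = blinfun_apply \<phi> v * blinfun_apply \<psi> w"
  unfolding covector_prod_def
  by (rule bilinear_form_apply[OF bounded_bilinear.comp[OF bounded_bilinear_mult
        blinfun.bounded_linear_right blinfun.bounded_linear_right]])

lemma bounded_bilinear_covector_prod: "bounded_bilinear covector_prod"
proof
  show "\<exists>K. \<forall>\<phi> \<psi>. norm (covector_prod \<phi> \<psi> :: 'a \<Rightarrow>\<^sub>L 'b \<Rightarrow>\<^sub>L real) \<le> norm \<phi> * norm \<psi> * K"
  proof (intro exI allI)
    fix \<phi> :: "'a \<Rightarrow>\<^sub>L real" and \<psi> :: "'b \<Rightarrow>\<^sub>L real"
    have "norm (blinfun_apply (blinfun_apply (covector_prod \<phi> \<psi>) v) w)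
            \<le> (norm \<phi> * norm v) * (norm \<psi> * norm w)" for v w
      unfolding covector_prod_apply norm_mult
      by (intro mult_mono norm_blinfun) auto
    then show "norm (covector_prod \<phi> \<psi>) \<le> norm \<phi> * norm \<psi> * 1"
      by (intro norm_blinfun_bound) (auto simp: mult_ac)
  qed
qed (auto intro!: blinfun_eqI simp: blinfun.bilinear_simps algebra_simps)

lemma tensor_ident_apply:
  "blinfun_apply (tensor_ident x) y =
     blinfun_apply y (bilinear_form (\<lambda>\<phi> \<psi>. blinfun_apply x (covector_prod \<phi> \<psi>)))"
  unfolding tensor_ident_def by (simp add: bounded_linear_Blinfun_apply)

lemma bounded_bilinear_apply_covector_prod:
  "bounded_bilinear (\<lambda>\<phi> \<psi>. blinfun_apply x (covector_prod \<phi> \<psi>))"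
proof -
  interpret cp: bounded_bilinear covector_prod
    by (rule bounded_bilinear_covector_prod)
  obtain K where K: "\<And>\<phi> \<psi>. norm (covector_prod \<phi> \<psi> :: 'a \<Rightarrow>\<^sub>L 'b \<Rightarrow>\<^sub>L real) \<le> norm \<phi> * norm \<psi> * K"
    using cp.bounded by blast
  show ?thesis
  proof
    show "\<exists>K. \<forall>a b. norm (blinfun_apply x (covector_prod a b)) \<le> norm a * norm b * K"
    proof (intro exI allI)
      fix a b
      have "norm (blinfun_apply x (covector_prod a b)) \<le> norm x * norm (covector_prod a b)"
        by (rule norm_blinfun)
      also have "\<dots> \<le> norm x * (norm a * norm b * K)"
        by (intro mult_left_mono K) auto
      finally show "norm (blinfun_apply x (covector_prod a b)) \<le> norm a * norm b * (K * norm x)"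
        by (simp add: mult_ac)
    qed
  qed (auto simp: cp.bilinear_simps blinfun.bilinear_simps)
qed

lemma tensor_ident_tensor_prod:
  "blinfun_apply (tensor_ident (tensor_prod v w)) (tensor_prod \<phi> \<psi>) =
     blinfun_apply \<phi> v * blinfun_apply \<psi> w"
  using bilinear_form_apply[OF bounded_bilinear_apply_covector_prod[of "tensor_prod v w"], of \<phi> \<psi>]
  by (simp add: tensor_ident_apply)

section \<open>Symmetric powers\<close>

text \<open>
  The integer \<open>n > 0\<close> is the cardinality of a finite (hence nonempty) index type \<^typ>\<open>'n\<close>.  The \<open>n\<close>-th symmetric
  power of \<open>V\<close> is realised as the dual of the space of symmetric \<open>n\<close>-linear forms on \<open>V\<close>, with
  \<open>v\<^sub>1 \<cdots> v\<^sub>n\<close> the evaluation at \<open>(v\<^sub>1, \<dots>, v\<^sub>n)\<close>.  The boundedness requirement holds automatically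
  in finite dimension.
\<close>

definition is_sym_form :: "(('n::finite \<Rightarrow> 'a::real_normed_vector) \<Rightarrow> real) \<Rightarrow> bool" where
  "is_sym_form m \<longleftrightarrow>
     (\<forall>v i. linear (\<lambda>x. m (v(i := x)))) \<and>
     (\<forall>v \<sigma>. \<sigma> permutes UNIV \<longrightarrow> m (v \<circ> \<sigma>) = m v) \<and>
     (\<exists>K. \<forall>v. \<bar>m v\<bar> \<le> K * (\<Prod>i\<in>UNIV. norm (v i)))"

lemma is_sym_formI:
  assumes "\<And>v i. linear (\<lambda>x. m (v(i := x)))"
    and "\<And>v \<sigma>. \<sigma> permutes UNIV \<Longrightarrow> m (v \<circ> \<sigma>) = m v"
    and "\<And>v. \<bar>m v\<bar> \<le> K * (\<Prod>i\<in>UNIV. norm (v i))"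
  shows "is_sym_form m"
  using assms unfolding is_sym_form_def by blast

lemma is_sym_form_linear: "is_sym_form m \<Longrightarrow> linear (\<lambda>x. m (v(i := x)))"
  and is_sym_form_permute: "is_sym_form m \<Longrightarrow> \<sigma> permutes UNIV \<Longrightarrow> m (v \<circ> \<sigma>) = m v"
  by (simp_all add: is_sym_form_def)

lemma is_sym_form_bound:
  assumes "is_sym_form m"
  obtains K where "0 \<le> K" "\<And>v. \<bar>m v\<bar> \<le> K * (\<Prod>i\<in>UNIV. norm (v i))"
proof -
  obtain K where K: "\<And>v. \<bar>m v\<bar> \<le> K * (\<Prod>i\<in>UNIV. norm (v i))"
    using assms unfolding is_sym_form_def by blast
  have "\<bar>m v\<bar> \<le> \<bar>K\<bar> * (\<Prod>i\<in>UNIV. norm (v i))" for v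
    by (rule order_trans[OF K mult_right_mono]) (auto intro: prod_nonneg)
  then show ?thesis by (rule that[OF abs_ge_zero])
qed

lemma is_sym_form_0: "is_sym_form (\<lambda>_. 0)"
  by (rule is_sym_formI[where K = 0]) (auto simp: linear_iff)

lemma is_sym_form_add:
  assumes f: "is_sym_form f" and g: "is_sym_form g"
  shows "is_sym_form (\<lambda>v. f v + g v)"
proof -
  obtain K where K: "\<And>v. \<bar>f v\<bar> \<le> K * (\<Prod>i\<in>UNIV. norm (v i))"
    using is_sym_form_bound[OF f] by blast
  obtain L where L: "\<And>v. \<bar>g v\<bar> \<le> L * (\<Prod>i\<in>UNIV. norm (v i))"
    using is_sym_form_bound[OF g] by blast
  have "\<bar>f v + g v\<bar> \<le> (K + L) * (\<Prod>i\<in>UNIV. norm (v i))" for v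
    using K[of v] L[of v] abs_triangle_ineq[of "f v" "g v"] unfolding distrib_right by linarith
  moreover have "linear (\<lambda>x. f (v(i := x)) + g (v(i := x)))" for v i
    by (rule linear_compose_add[OF is_sym_form_linear[OF f] is_sym_form_linear[OF g]])
  ultimately show ?thesis
    by (intro is_sym_formI[where K = "K + L"])
       (simp_all add: is_sym_form_permute[OF f] is_sym_form_permute[OF g])
qed

lemma is_sym_form_scale:
  assumes f: "is_sym_form f"
  shows "is_sym_form (\<lambda>v. r * f v)"
proof -
  obtain K where K: "\<And>v. \<bar>f v\<bar> \<le> K * (\<Prod>i\<in>UNIV. norm (v i))"
    using is_sym_form_bound[OF f] by blast
  have "\<bar>r * f v\<bar> \<le> (\<bar>r\<bar> * K) * (\<Prod>i\<in>UNIV. norm (v i))" for v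
    unfolding abs_mult mult.assoc by (intro mult_left_mono K) simp
  moreover have "linear (\<lambda>x. r * f (v(i := x)))" for v i
    using linear_compose_scale_right[OF is_sym_form_linear[OF f, of v i], of r] by simp
  ultimately show ?thesis
    by (intro is_sym_formI[where K = "\<bar>r\<bar> * K"]) (simp_all add: is_sym_form_permute[OF f])
qed

typedef (overloaded) ('n, 'a) sym_form =
  "{m :: ('n::finite \<Rightarrow> 'a::real_normed_vector) \<Rightarrow> real. is_sym_form m}"
  morphisms sym_form_apply Sym_form
  using is_sym_form_0 by blast

setup_lifting type_definition_sym_form

lemma is_sym_form_apply: "is_sym_form (sym_form_apply m)"
  using sym_form_apply[of m] by simp

lemma sym_form_eqI: "(\<And>v. sym_form_apply a v = sym_form_apply b v) \<Longrightarrow> a = b"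
  by transfer auto

lemma sym_form_apply_zero_arg:
  assumes "v i = 0" shows "sym_form_apply m v = 0"
proof -
  have "sym_form_apply m (v(i := 0)) = 0"
    using linear_0[OF is_sym_form_linear[OF is_sym_form_apply[of m], of v i]] .
  then show ?thesis using assms by (metis fun_upd_triv)
qed

instantiation sym_form :: (finite, real_normed_vector) real_normed_vector
begin

lift_definition zero_sym_form :: "('a, 'b) sym_form" is "\<lambda>_. 0"
  by (rule is_sym_form_0)

lift_definition plus_sym_form ::
    "('a, 'b) sym_form \<Rightarrow> ('a, 'b) sym_form \<Rightarrow> ('a, 'b) sym_form" is "\<lambda>f g v. f v + g v"
  by (rule is_sym_form_add)

lift_definition scaleR_sym_form :: "real \<Rightarrow> ('a, 'b) sym_form \<Rightarrow> ('a, 'b) sym_form"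
  is "\<lambda>r f v. r * f v"
  by (rule is_sym_form_scale)

definition uminus_sym_form :: "('a, 'b) sym_form \<Rightarrow> ('a, 'b) sym_form" where
  "uminus_sym_form m = (- 1) *\<^sub>R m"

definition minus_sym_form :: "('a, 'b) sym_form \<Rightarrow> ('a, 'b) sym_form \<Rightarrow> ('a, 'b) sym_form" where
  "minus_sym_form a b = a + (- b)"

definition norm_sym_form :: "('a, 'b) sym_form \<Rightarrow> real" where
  "norm_sym_form m = (SUP v. \<bar>sym_form_apply m v\<bar> / (\<Prod>i\<in>UNIV. norm (v i)))"

definition dist_sym_form :: "('a, 'b) sym_form \<Rightarrow> ('a, 'b) sym_form \<Rightarrow> real" where
  "dist_sym_form a b = norm (a - b)"

definition [code del]:
  "(uniformity :: (('a, 'b) sym_form \<times> ('a, 'b) sym_form) filter) =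
     (INF e\<in>{0 <..}. principal {(x, y). dist x y < e})"

definition open_sym_form :: "('a, 'b) sym_form set \<Rightarrow> bool" where
  [code del]: "open_sym_form S = (\<forall>x\<in>S. \<forall>\<^sub>F (x', y) in uniformity. x' = x \<longrightarrow> y \<in> S)"

definition sgn_sym_form :: "('a, 'b) sym_form \<Rightarrow> ('a, 'b) sym_form" where
  "sgn_sym_form x = scaleR (inverse (norm x)) x"

lemma divide_prod_norm_le:
  fixes v :: "'a \<Rightarrow> 'b"
  assumes "0 \<le> K" "c \<le> K * (\<Prod>i\<in>UNIV. norm (v i))"
  shows "c / (\<Prod>i\<in>UNIV. norm (v i)) \<le> K"
proof -
  have "0 \<le> (\<Prod>i\<in>UNIV. norm (v i))" by (intro prod_nonneg) simp
  then consider "(\<Prod>i\<in>UNIV. norm (v i)) = 0" | "0 < (\<Prod>i\<in>UNIV. norm (v i))" by linarith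
  then show ?thesis
  proof cases
    case 1
    show ?thesis unfolding 1 using assms(1) by simp
  next
    case 2
    then show ?thesis using assms(2) by (subst pos_divide_le_eq)
  qed
qed

lemma sym_form_bdd_above:
  fixes m :: "('a, 'b) sym_form"
  shows "bdd_above (range (\<lambda>v. \<bar>sym_form_apply m v\<bar> / (\<Prod>i\<in>UNIV. norm (v i))))"
proof -
  obtain K where "0 \<le> K" "\<And>v. \<bar>sym_form_apply m v\<bar> \<le> K * (\<Prod>i\<in>UNIV. norm (v i))"
    using is_sym_form_bound[OF is_sym_form_apply[of m]] by blast
  then show ?thesis
    by (intro bdd_aboveI2[where M = K] divide_prod_norm_le)
qed

lemma norm_sym_form_upper:
  fixes m :: "('a, 'b) sym_form"
  shows "\<bar>sym_form_apply m v\<bar> / (\<Prod>i\<in>UNIV. norm (v i)) \<le> norm m"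
  unfolding norm_sym_form_def by (intro cSUP_upper sym_form_bdd_above) auto

lemma norm_sym_form_bound:
  fixes m :: "('a, 'b) sym_form"
  shows "\<bar>sym_form_apply m v\<bar> \<le> norm m * (\<Prod>i\<in>UNIV. norm (v i))"
proof (cases "\<exists>i. v i = 0")
  case True
  then have "sym_form_apply m v = 0" "(\<Prod>i\<in>UNIV. norm (v i)) = 0"
    by (auto simp: sym_form_apply_zero_arg)
  then show ?thesis by (simp only: abs_zero mult_zero_right order_refl)
next
  case False
  then have "0 < (\<Prod>i\<in>UNIV. norm (v i))" by (intro prod_pos) auto
  then show ?thesis using norm_sym_form_upper[of m v] by (subst (asm) pos_divide_le_eq)
qed

lemma norm_sym_form_leI:
  fixes m :: "('a, 'b) sym_form"
  assumes "0 \<le> K" "\<And>v. \<bar>sym_form_apply m v\<bar> \<le> K * (\<Prod>i\<in>UNIV. norm (v i))"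
  shows "norm m \<le> K"
  unfolding norm_sym_form_def
  by (intro cSUP_least divide_prod_norm_le assms) simp

lemma norm_sym_form_nonneg: "0 \<le> norm (m :: ('a, 'b) sym_form)"
  by (rule order_trans[OF _ norm_sym_form_upper[of m "\<lambda>_. 0"]])
     (intro divide_nonneg_nonneg prod_nonneg; simp)

instance
proof
  fix a b c :: "('a, 'b) sym_form" and r s :: real
  show "a + b + c = a + (b + c)" "a + b = b + a" "0 + a = a"
    by (transfer; auto)+
  show "- a + a = 0"
    unfolding uminus_sym_form_def by transfer auto
  show "a - b = a + - b"
    by (rule minus_sym_form_def)
  show "r *\<^sub>R (a + b) = r *\<^sub>R a + r *\<^sub>R b" "(r + s) *\<^sub>R a = r *\<^sub>R a + s *\<^sub>R a"
    by (transfer; auto simp: algebra_simps)+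
  show "r *\<^sub>R s *\<^sub>R a = (r * s) *\<^sub>R a" "1 *\<^sub>R a = a"
    by (transfer; auto)+
  show "dist a b = norm (a - b)" "sgn a = inverse (norm a) *\<^sub>R a"
    by (simp_all add: dist_sym_form_def sgn_sym_form_def)
  show "(uniformity :: (('a, 'b) sym_form \<times> ('a, 'b) sym_form) filter) =
     (INF e\<in>{0 <..}. principal {(x, y). dist x y < e})"
    by (rule uniformity_sym_form_def)
  show "open U = (\<forall>x\<in>U. \<forall>\<^sub>F (x', y) in uniformity. x' = x \<longrightarrow> y \<in> U)"
    for U :: "('a, 'b) sym_form set"
    by (rule open_sym_form_def)
  show "norm a = 0 \<longleftrightarrow> a = 0"
  proof
    assume "norm a = 0"
    then have "sym_form_apply a v = 0" for v
      using norm_sym_form_bound[of a v] by simp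
    then show "a = 0" by (intro sym_form_eqI) (simp add: zero_sym_form.rep_eq)
  next
    assume "a = 0"
    then show "norm a = 0" by (simp add: norm_sym_form_def zero_sym_form.rep_eq)
  qed
  show "norm (a + b) \<le> norm a + norm b"
  proof (rule norm_sym_form_leI)
    fix v
    have "\<bar>sym_form_apply (a + b) v\<bar> \<le> \<bar>sym_form_apply a v\<bar> + \<bar>sym_form_apply b v\<bar>"
      by (simp add: plus_sym_form.rep_eq)
    also have "\<dots> \<le> (norm a + norm b) * (\<Prod>i\<in>UNIV. norm (v i))"
      unfolding distrib_right by (intro add_mono norm_sym_form_bound)
    finally show "\<bar>sym_form_apply (a + b) v\<bar> \<le> (norm a + norm b) * (\<Prod>i\<in>UNIV. norm (v i))" .
  qed (simp add: norm_sym_form_nonneg)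
  have le: "norm (t *\<^sub>R c) \<le> \<bar>t\<bar> * norm c" for t and c :: "('a, 'b) sym_form"
  proof (rule norm_sym_form_leI)
    show "\<bar>sym_form_apply (t *\<^sub>R c) v\<bar> \<le> \<bar>t\<bar> * norm c * (\<Prod>i\<in>UNIV. norm (v i))" for v
      unfolding scaleR_sym_form.rep_eq abs_mult mult.assoc
      by (intro mult_left_mono norm_sym_form_bound) simp
  qed (simp add: norm_sym_form_nonneg)
  show "norm (r *\<^sub>R a) = \<bar>r\<bar> * norm a"
  proof (cases "r = 0")
    case True
    then show ?thesis using le[of 0 a] norm_sym_form_nonneg[of "0 *\<^sub>R a"] by simp
  next
    case False
    have "inverse r *\<^sub>R r *\<^sub>R a = a"
      using False by (intro sym_form_eqI) (simp add: scaleR_sym_form.rep_eq)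
    then have "norm a \<le> \<bar>inverse r\<bar> * norm (r *\<^sub>R a)"
      using le[of "inverse r" "r *\<^sub>R a"] by simp
    then have "\<bar>r\<bar> * norm a \<le> norm (r *\<^sub>R a)"
      using False by (simp add: field_simps)
    then show ?thesis using le[of r a] by simp
  qed
qed

end

lemma bounded_linear_sym_form_apply:
  fixes v :: "'n::finite \<Rightarrow> 'a::real_normed_vector"
  shows "bounded_linear (\<lambda>m. sym_form_apply m v)"
  by (rule bounded_linear_intro[where K = "\<Prod>i\<in>UNIV. norm (v i)"])
     (simp_all add: plus_sym_form.rep_eq scaleR_sym_form.rep_eq norm_sym_form_bound
        del: prod_constant)

type_synonym ('n, 'a) sym_power = "('n, 'a) sym_form \<Rightarrow>\<^sub>L real"

definition sym_prod ::
    "('n::finite \<Rightarrow> 'a::real_normed_vector) \<Rightarrow> ('n, 'a) sym_power" where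
  "sym_prod v = Blinfun (\<lambda>m. sym_form_apply m v)"

lemma sym_prod_apply [simp]: "blinfun_apply (sym_prod v) m = sym_form_apply m v"
  by (simp add: sym_prod_def bounded_linear_Blinfun_apply bounded_linear_sym_form_apply)

definition sym_cone :: "'a::real_normed_vector set \<Rightarrow> ('n::finite, 'a) sym_power set" where
  "sym_cone C = convex_cone hull {sym_prod v | v. \<forall>i. v i \<in> C}"

text \<open>\<open>Sym\<^sup>n(f)\<close> is the transpose of the pullback of symmetric forms along \<open>f\<close>.\<close>

lift_definition sym_form_pullback ::
    "('a::real_normed_vector \<Rightarrow>\<^sub>L 'b::real_normed_vector) \<Rightarrow>
     ('n::finite, 'b) sym_form \<Rightarrow> ('n, 'a) sym_form"
  is "\<lambda>f m v. m (\<lambda>i. f (v i))"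
proof -
  fix f :: "'a \<Rightarrow> 'b" and m :: "('n \<Rightarrow> 'b) \<Rightarrow> real"
  assume f: "bounded_linear f" and m: "is_sym_form m"
  obtain K where K: "0 \<le> K" "\<And>w. \<bar>m w\<bar> \<le> K * (\<Prod>i\<in>UNIV. norm (w i))"
    using is_sym_form_bound[OF m] by blast
  show "is_sym_form (\<lambda>v. m (\<lambda>i. f (v i)))"
  proof (rule is_sym_formI)
    fix v :: "'n \<Rightarrow> 'a" and i
    have "(\<lambda>x. m (\<lambda>j. f ((v(i := x)) j))) = (\<lambda>y. m ((\<lambda>j. f (v j))(i := y))) \<circ> f"
      by (auto simp: fun_upd_def if_distrib[of f] fun_eq_iff intro!: arg_cong[of _ _ m])
    then show "linear (\<lambda>x. m (\<lambda>j. f ((v(i := x)) j)))"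
      using linear_compose[OF bounded_linear.linear[OF f] is_sym_form_linear[OF m]] by simp
  next
    fix v :: "'n \<Rightarrow> 'a" and \<sigma> :: "'n \<Rightarrow> 'n"
    assume "\<sigma> permutes UNIV"
    from is_sym_form_permute[OF m this, of "\<lambda>i. f (v i)"]
    show "m (\<lambda>i. f ((v \<circ> \<sigma>) i)) = m (\<lambda>i. f (v i))" by (simp add: o_def)
  next
    fix v :: "'n \<Rightarrow> 'a"
    have "\<bar>m (\<lambda>i. f (v i))\<bar> \<le> K * (\<Prod>i\<in>UNIV. norm (f (v i)))" by (rule K)
    also have "\<dots> \<le> K * (\<Prod>i\<in>UNIV. onorm f * norm (v i))"
      using K(1) f by (intro mult_left_mono prod_mono) (auto intro: onorm)
    finally show "\<bar>m (\<lambda>i. f (v i))\<bar> \<le>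
        (K * (\<Prod>i\<in>(UNIV::'n set). onorm f)) * (\<Prod>i\<in>UNIV. norm (v i))"
      by (simp only: prod.distrib mult.assoc)
  qed
qed

lemma bounded_linear_sym_form_pullback: "bounded_linear (sym_form_pullback f)"
proof (rule bounded_linear_intro)
  fix m :: "('n::finite, 'b) sym_form"
  show "norm (sym_form_pullback f m) \<le> norm m * (\<Prod>i\<in>(UNIV::'n set). norm f)"
  proof (rule norm_sym_form_leI)
    fix v
    have "\<bar>sym_form_apply (sym_form_pullback f m) v\<bar>
            \<le> norm m * (\<Prod>i\<in>UNIV. norm (blinfun_apply f (v i)))"
      unfolding sym_form_pullback.rep_eq by (rule norm_sym_form_bound)
    also have "\<dots> \<le> norm m * (\<Prod>i\<in>UNIV. norm f * norm (v i))"
      by (intro mult_left_mono prod_mono) (auto intro: norm_blinfun)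
    finally show "\<bar>sym_form_apply (sym_form_pullback f m) v\<bar>
        \<le> norm m * (\<Prod>i\<in>(UNIV::'n set). norm f) * (\<Prod>i\<in>UNIV. norm (v i))"
      by (simp only: prod.distrib mult.assoc)
  qed (intro mult_nonneg_nonneg prod_nonneg norm_ge_zero)
qed (auto intro!: sym_form_eqI
       simp: sym_form_pullback.rep_eq plus_sym_form.rep_eq scaleR_sym_form.rep_eq)

definition sym_map ::
    "('a::real_normed_vector \<Rightarrow>\<^sub>L 'b::real_normed_vector) \<Rightarrow>
     ('n::finite, 'a) sym_power \<Rightarrow>\<^sub>L ('n, 'b) sym_power" where
  "sym_map f = transpose_map (Blinfun (sym_form_pullback f))"

lemma sym_map_sym_prod:
  "blinfun_apply (sym_map f) (sym_prod v) = sym_prod (\<lambda>i. blinfun_apply f (v i))"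
  by (rule blinfun_eqI)
     (simp add: sym_map_def bounded_linear_Blinfun_apply bounded_linear_sym_form_pullback
        sym_form_pullback.rep_eq)

text \<open>
  The canonical map \<open>Sym\<^sup>n(V) \<rightarrow> Sym\<^sup>n(V\<^sup>*)\<^sup>*\<close>, determined by pairing \<open>v\<^sub>1 \<cdots> v\<^sub>n\<close> with
  \<open>\<phi>\<^sub>1 \<cdots> \<phi>\<^sub>n\<close> to \<open>sym_pairing \<phi> v\<close>.
\<close>

definition sym_pairing ::
    "('n::finite \<Rightarrow> 'a::real_normed_vector \<Rightarrow>\<^sub>L real) \<Rightarrow> ('n \<Rightarrow> 'a) \<Rightarrow> real" where
  "sym_pairing \<phi> v =
     (\<Sum>\<sigma> | \<sigma> permutes UNIV. \<Prod>i\<in>UNIV. blinfun_apply (\<phi> i) (v (\<sigma> i))) / fact CARD('n)"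

lemma sym_pairing_alt:
  fixes \<phi> :: "'n::finite \<Rightarrow> 'a::real_normed_vector \<Rightarrow>\<^sub>L real"
  shows "sym_pairing \<phi> v =
     (\<Sum>\<sigma> | \<sigma> permutes UNIV. \<Prod>i\<in>UNIV. blinfun_apply (\<phi> (\<sigma> i)) (v i)) / fact CARD('n)"
proof -
  have "(\<Sum>\<sigma> | \<sigma> permutes UNIV. \<Prod>i\<in>UNIV. blinfun_apply (\<phi> i) (v (\<sigma> i))) =
        (\<Sum>\<sigma> | \<sigma> permutes (UNIV::'n set). \<Prod>i\<in>UNIV. blinfun_apply (\<phi> i) (v (inv \<sigma> i)))"
    by (rule sum_permutations_inverse)
  also have "\<dots> = (\<Sum>\<sigma> | \<sigma> permutes UNIV. \<Prod>i\<in>UNIV. blinfun_apply (\<phi> (\<sigma> i)) (v i))"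
  proof (rule sum.cong[OF refl], clarsimp)
    fix \<sigma> :: "'n \<Rightarrow> 'n" assume s: "\<sigma> permutes UNIV"
    show "(\<Prod>i\<in>UNIV. blinfun_apply (\<phi> i) (v (inv \<sigma> i))) = (\<Prod>i\<in>UNIV. blinfun_apply (\<phi> (\<sigma> i)) (v i))"
      using prod.permute[OF s, of "\<lambda>i. blinfun_apply (\<phi> i) (v (inv \<sigma> i))"]
      by (simp add: o_def permutes_inverses(2)[OF s])
  qed
  finally show ?thesis by (simp add: sym_pairing_def)
qed

lemma sym_pairing_permute_left:
  assumes "\<tau> permutes UNIV" shows "sym_pairing (\<phi> \<circ> \<tau>) v = sym_pairing \<phi> v"
  unfolding sym_pairing_alt
  by (subst (2) setum_permutations_compose_left[OF assms]) (simp add: o_def)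

lemma sym_pairing_permute_right:
  assumes "\<tau> permutes UNIV" shows "sym_pairing \<phi> (v \<circ> \<tau>) = sym_pairing \<phi> v"
  unfolding sym_pairing_def
  by (subst (2) setum_permutations_compose_left[OF assms]) (simp add: o_def)

lemma abs_sym_pairing_le:
  fixes \<phi> :: "'n::finite \<Rightarrow> 'a::real_normed_vector \<Rightarrow>\<^sub>L real"
  shows "\<bar>sym_pairing \<phi> v\<bar> \<le> (\<Prod>i\<in>UNIV. norm (\<phi> i)) * (\<Prod>i\<in>UNIV. norm (v i))"
proof -
  let ?P = "{\<sigma> :: 'n \<Rightarrow> 'n. \<sigma> permutes UNIV}"
  let ?B = "(\<Prod>i\<in>UNIV. norm (\<phi> i)) * (\<Prod>i\<in>UNIV. norm (v i))"
  have "\<bar>\<Prod>i\<in>UNIV. blinfun_apply (\<phi> i) (v (\<sigma> i))\<bar> \<le> ?B" if "\<sigma> \<in> ?P" for \<sigma>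
  proof -
    have "\<bar>\<Prod>i\<in>UNIV. blinfun_apply (\<phi> i) (v (\<sigma> i))\<bar> \<le> (\<Prod>i\<in>UNIV. norm (\<phi> i) * norm (v (\<sigma> i)))"
      unfolding abs_prod
      by (intro prod_mono conjI abs_ge_zero) (metis norm_blinfun real_norm_def)
    also have "\<dots> = ?B"
      using that prod.permute[of \<sigma> UNIV "\<lambda>i. norm (v i)"] by (simp add: prod.distrib o_def)
    finally show ?thesis .
  qed
  then have "\<bar>\<Sum>\<sigma>\<in>?P. \<Prod>i\<in>UNIV. blinfun_apply (\<phi> i) (v (\<sigma> i))\<bar> \<le> (\<Sum>\<sigma>\<in>?P. ?B)"
    by (intro order_trans[OF sum_abs] sum_mono)
  also have "(\<Sum>\<sigma>\<in>?P. ?B) = fact CARD('n) * ?B"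
    by (simp add: card_permutations[OF refl finite])
  finally have "\<bar>\<Sum>\<sigma>\<in>?P. \<Prod>i\<in>UNIV. blinfun_apply (\<phi> i) (v (\<sigma> i))\<bar> \<le> fact CARD('n) * ?B" .
  then show ?thesis
    by (simp add: sym_pairing_def pos_divide_le_eq mult.commute del: prod_constant)
qed

lemma linear_sum_prod_upd:
  fixes L :: "'s \<Rightarrow> 'n::finite \<Rightarrow> 'a::real_vector \<Rightarrow> real"
  assumes "\<And>s i. linear (L s i)"
  shows "linear (\<lambda>x. (\<Sum>s\<in>S. \<Prod>j\<in>UNIV. L s j ((v(i := x)) j)) / c)"
proof -
  have "(\<Prod>j\<in>UNIV. L s j ((v(i := x)) j)) = (\<Prod>j\<in>UNIV - {i}. L s j (v j)) * L s i x" for s x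
    by (subst prod.remove[of _ i]) (auto simp: mult.commute intro!: prod.cong)
  moreover have "linear (\<lambda>x. (\<Sum>s\<in>S. (\<Prod>j\<in>UNIV - {i}. L s j (v j)) * L s i x) / c)"
    using assms
    by (simp add: linear_iff distrib_left sum.distrib add_divide_distrib sum_distrib_left
        mult.left_commute sum_divide_distrib)
  ultimately show ?thesis by simp
qed

lemma linear_sym_pairing_right: "linear (\<lambda>x. sym_pairing \<phi> (v(i := x)))"
  unfolding sym_pairing_alt
  by (rule linear_sum_prod_upd) (rule bounded_linear.linear[OF blinfun.bounded_linear_right])

lemma linear_sym_pairing_left: "linear (\<lambda>x. sym_pairing (\<phi>(i := x)) v)"
  unfolding sym_pairing_def
  by (rule linear_sum_prod_upd[where L = "\<lambda>\<sigma> i \<psi>. blinfun_apply \<psi> (v (\<sigma> i))"])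
     (rule bounded_linear.linear[OF blinfun.bounded_linear_left])

lift_definition covector_sym_prod ::
    "('n::finite \<Rightarrow> 'a::real_normed_vector \<Rightarrow>\<^sub>L real) \<Rightarrow> ('n, 'a) sym_form" is sym_pairing
  by (rule is_sym_formI[OF linear_sym_pairing_right sym_pairing_permute_right abs_sym_pairing_le])

lemma is_sym_form_apply_covector_sym_prod:
  "is_sym_form (\<lambda>\<phi>. blinfun_apply x (covector_sym_prod \<phi>))"
proof (rule is_sym_formI)
  fix \<phi> :: "'a \<Rightarrow> 'b \<Rightarrow>\<^sub>L real" and i
  have "covector_sym_prod (\<phi>(i := a + b)) =
          covector_sym_prod (\<phi>(i := a)) + covector_sym_prod (\<phi>(i := b))"
       "covector_sym_prod (\<phi>(i := r *\<^sub>R a)) = r *\<^sub>R covector_sym_prod (\<phi>(i := a))" for a b r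
    using linear_sym_pairing_left[of \<phi> i]
    by (auto intro!: sym_form_eqI simp: linear_iff covector_sym_prod.rep_eq plus_sym_form.rep_eq
        scaleR_sym_form.rep_eq)
  then show "linear (\<lambda>\<psi>. blinfun_apply x (covector_sym_prod (\<phi>(i := \<psi>))))"
    by (simp add: linear_iff blinfun.add_right blinfun.scaleR_right)
next
  fix \<phi> :: "'a \<Rightarrow> 'b \<Rightarrow>\<^sub>L real" and \<sigma> :: "'a \<Rightarrow> 'a"
  assume "\<sigma> permutes UNIV"
  then have "covector_sym_prod (\<phi> \<circ> \<sigma>) = covector_sym_prod \<phi>"
    by (intro sym_form_eqI) (simp add: covector_sym_prod.rep_eq sym_pairing_permute_left)
  then show "blinfun_apply x (covector_sym_prod (\<phi> \<circ> \<sigma>)) = blinfun_apply x (covector_sym_prod \<phi>)"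
    by simp
next
  fix \<phi> :: "'a \<Rightarrow> 'b \<Rightarrow>\<^sub>L real"
  have "norm (covector_sym_prod \<phi>) \<le> (\<Prod>i\<in>UNIV. norm (\<phi> i))"
    by (rule norm_sym_form_leI)
       (auto simp: covector_sym_prod.rep_eq abs_sym_pairing_le intro: prod_nonneg)
  then have "norm x * norm (covector_sym_prod \<phi>) \<le> norm x * (\<Prod>i\<in>UNIV. norm (\<phi> i))"
    by (intro mult_left_mono) auto
  then show "\<bar>blinfun_apply x (covector_sym_prod \<phi>)\<bar> \<le> norm x * (\<Prod>i\<in>UNIV. norm (\<phi> i))"
    using norm_blinfun[of x "covector_sym_prod \<phi>"] by simp
qed

definition sym_ident ::
    "('n::finite, 'a::real_normed_vector) sym_power \<Rightarrow> ('n, 'a \<Rightarrow>\<^sub>L real) sym_power \<Rightarrow>\<^sub>L real" where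
  "sym_ident x =
     Blinfun (\<lambda>y. blinfun_apply y (Sym_form (\<lambda>\<phi>. blinfun_apply x (covector_sym_prod \<phi>))))"

lemma sym_ident_sym_prod:
  "blinfun_apply (sym_ident (sym_prod v)) (sym_prod \<phi>) = sym_pairing \<phi> v"
proof -
  have "blinfun_apply (sym_ident (sym_prod v)) (sym_prod \<phi>) =
      sym_form_apply (Sym_form (\<lambda>\<phi>. blinfun_apply (sym_prod v) (covector_sym_prod \<phi>))) \<phi>"
    unfolding sym_ident_def by (simp add: bounded_linear_Blinfun_apply)
  also have "\<dots> = blinfun_apply (sym_prod v) (covector_sym_prod \<phi>)"
    by (subst Sym_form_inverse) (simp_all only: mem_Collect_eq is_sym_form_apply_covector_sym_prod)
  finally show ?thesis by (simp add: covector_sym_prod.rep_eq)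
qed

end

theory Submission
  imports Defs
begin

text \<open>
  Two observations carry the statement. First, the cones \<open>Sym\<^sup>n(B)\<close> and
  \<open>B\<^sub>1 \<otimes> B\<^sub>2\<close> are closed (\<open>closed_sym_cone\<close>,
  \<open>closed_tensor_cone\<close>): products of unit vectors form a compact generating set on which a
  functional is positive, pointedness of the factors providing this functional, and in finite dimension the
  convex cone over such a set is closed by Caratheodory's theorem. Second, a strong injection
  \<open>h : A \<rightarrow> B\<close> has a transpose \<open>B\<^sup>* \<rightarrow> A\<^sup>*\<close> with
  dense image (\<open>dense_image_transpose\<close>), by separation of a point from a closed convex cone.

  Dense images then do all the work. If \<open>f(A)\<close> is dense in \<open>B\<close>, then by joint
  continuity of the product every generator of \<open>Sym\<^sup>n(B)\<close> or
  \<open>B\<^sub>1 \<otimes> B\<^sub>2\<close> is a limit of images of generators, and closedness of the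
  target gives density of the image in the required sense. As \<open>B\<close> spans its ambient space, a
  linear map on that space is determined on the dense image, and whether it maps \<open>B\<close> into a
  closed cone is decided there (\<open>strongly_injective_precomp\<close>); this gives the statement on
  \<open>f\<^sup>*\<close>, and, with \<open>C\<close> the half line, strong injectivity of the transpose of
  \<open>f\<close>, to which the obvious fact that post-composition preserves strong injectivity is applied.

  For a strong injection \<open>h\<close>, the same lemma applied to the dense transpose of \<open>h\<close>
  gives the statement on \<open>h\<^sup>*\<^sup>*\<close>; the full-dimensionality of
  \<open>A\<^sup>*\<close> that it needs follows from the pointedness of \<open>A\<close>. An element
  \<open>x\<close> lies in \<open>Sym\<^sup>n(A\<^sup>*)\<^sup>*\<close> exactly if its pairing with all
  \<open>\<alpha>\<^sub>1 \<cdots> \<alpha>\<^sub>n\<close>,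
  \<open>\<alpha>\<^sub>i \<in> A\<^sup>*\<close>, is nonnegative, and by density of the transpose it
  suffices to take \<open>\<alpha>\<^sub>i = \<beta>\<^sub>i \<circ> h\<close> with
  \<open>\<beta>\<^sub>i \<in> B\<^sup>*\<close>. But then the pairing is that of
  \<open>Sym\<^sup>n(h) x\<close> with \<open>\<beta>\<^sub>1 \<cdots> \<beta>\<^sub>n\<close>. So
  \<open>Sym\<^sup>n(A\<^sup>*)\<^sup>*\<close> is exactly the preimage of
  \<open>Sym\<^sup>n(B\<^sup>*)\<^sup>*\<close> (\<open>sym_bidual_sym_map_iff\<close>). As
  \<open>Sym\<^sup>n(B)\<close> contains the image of \<open>Sym\<^sup>n(A)\<close> and is contained in
  \<open>Sym\<^sup>n(B\<^sup>*)\<^sup>*\<close>, the inclusions follow. Tensor products behave in the same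
  way.

  The ambient spaces are normed types with a finite spanning set, not Euclidean spaces, so the compactness,
  separation and reflexivity facts are derived from coordinates with respect to such a set.
\<close>

section \<open>Finite-dimensional normed spaces\<close>

text \<open>
  Finiteness of the dimension is stated for a set of vectors, not for a type, so that it can be proved by
  induction along a chain of subspaces in \<open>finite_dim_separating_functionals\<close>.
\<close>
definition finite_dim :: "'a::real_vector set \<Rightarrow> bool" where
  "finite_dim V \<longleftrightarrow> (\<exists>B. finite B \<and> V \<subseteq> span B)"

text \<open>
  Tychonoff's theorem for the product topology on a function type, without the extensionality condition of
  \<^const>\<open>PiE\<close>.
\<close>
lemma compact_Pi_UNIV:
  fixes K :: "'i \<Rightarrow> 'b::topological_space set"
  assumes "\<And>i. compact (K i)"
  shows "compact {c. \<forall>i. c i \<in> K i}"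
proof -
  have "compactin (product_topology (\<lambda>_. euclidean) UNIV) (PiE UNIV K)"
    using assms by (simp add: compactin_PiE)
  moreover have "PiE UNIV K = {c. \<forall>i. c i \<in> K i}"
    by (auto simp: PiE_def Pi_def)
  ultimately show ?thesis
    by (simp add: euclidean_product_topology)
qed

lemma compact_gauge_bound:
  fixes g :: "'a::topological_space \<Rightarrow> real"
  assumes "compact S" "continuous_on S g" "\<And>x. x \<in> S \<Longrightarrow> 0 < g x"
  obtains \<delta> where "0 < \<delta>" "\<And>x. x \<in> S \<Longrightarrow> \<delta> \<le> g x"
proof (cases "S = {}")
  case True
  then show ?thesis using that[of 1] by simp
next
  case False
  then obtain y where "y \<in> S" "\<forall>x\<in>S. g y \<le> g x"
    using continuous_attains_inf[OF assms(1) _ assms(2)] by blast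
  then show ?thesis using that[of "g y"] assms(3) by blast
qed

lemma continuous_on_lincomb:
  fixes B :: "'a::real_normed_vector set"
  shows "continuous_on X (\<lambda>c :: 'a \<Rightarrow> real. \<Sum>b\<in>B. c b *\<^sub>R b)"
  by (intro continuous_intros continuous_on_subset[OF continuous_on_product_coordinates]) simp

text \<open>
  Coordinates are continuous because the coefficient vectors of maximum norm 1 form a compact set, on which,
  by independence of the basis, the norm of the linear combination does not vanish; so it is bounded below
  there, and homogeneity does the rest.
\<close>
lemma finite_dim_representation_bounded:
  fixes B :: "'a::real_normed_vector set"
  assumes fin: "finite B" and ind: "independent B" and sp: "span B = UNIV"
  obtains K where "0 \<le> K" "\<And>x b. \<bar>representation B x b\<bar> \<le> K * norm x"
proof -
  let ?r = "representation B"
  have expand: "(\<Sum>b\<in>B. ?r x b *\<^sub>R b) = x" for x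
    by (rule real_vector.sum_representation_eq) (use assms in auto)
  \<comment> \<open>Coefficient functions bounded by 1, with the bound attained at some basis element.\<close>
  define S where "S = (\<Union>b\<in>B. {c :: 'a \<Rightarrow> real. \<forall>i. c i \<in> (if i = b then {-1, 1} else {-1..1})})"
  have S: "compact S"
    unfolding S_def by (intro compact_UN fin compact_Pi_UNIV) auto
  have pos: "0 < norm (\<Sum>b\<in>B. c b *\<^sub>R b)" if "c \<in> S" for c
  proof -
    obtain b where b: "b \<in> B" and "\<forall>i. c i \<in> (if i = b then {-1, 1} else {-1..1})"
      using \<open>c \<in> S\<close> unfolding S_def by blast
    then have "c b \<in> {-1, 1}" by (metis (full_types))
    then have "c b \<noteq> 0" by auto
    with b show ?thesis
      using ind fin by (auto simp: real_vector.dependent_finite)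
  qed
  obtain \<delta> where \<delta>: "0 < \<delta>" "\<And>c. c \<in> S \<Longrightarrow> \<delta> \<le> norm (\<Sum>b\<in>B. c b *\<^sub>R b)"
    using compact_gauge_bound[OF S continuous_on_norm[OF continuous_on_lincomb] pos] by blast
  have "\<bar>?r x b\<bar> \<le> (1 / \<delta>) * norm x" for x b
  proof (cases "?r x b = 0")
    case True
    then show ?thesis using \<delta>(1) by simp
  next
    case False
    then have "b \<in> B" by (rule real_vector.representation_ne_zero)
    define M where "M = Max ((\<lambda>b. \<bar>?r x b\<bar>) ` B)"
    have M: "\<bar>?r x b'\<bar> \<le> M" if "b' \<in> B" for b'
      unfolding M_def using that fin by simp
    obtain m where m: "m \<in> B" "M = \<bar>?r x m\<bar>"
      unfolding M_def using \<open>b \<in> B\<close> fin Max_in[of "(\<lambda>b. \<bar>?r x b\<bar>) ` B"] by fastforce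
    have "0 < M" using M[OF \<open>b \<in> B\<close>] False by simp
    have "\<bar>?r x i\<bar> \<le> M" for i
      using M[of i] \<open>0 < M\<close> real_vector.representation_ne_zero[of B x i] by (cases "?r x i = 0") auto
    then have "- M \<le> ?r x i \<and> ?r x i \<le> M" for i
      by (metis abs_le_iff minus_le_iff)
    then have "?r x i / M \<in> {-1..1}" for i
      using \<open>0 < M\<close> by (simp add: field_simps)
    moreover have "?r x m / M \<in> {-1, 1}"
      using m(2) \<open>0 < M\<close> by (auto simp: abs_if split: if_splits)
    ultimately have "(\<lambda>i. ?r x i / M) \<in> S"
      unfolding S_def using m(1) by (intro UN_I[of m]) simp_all
    from \<delta>(2)[OF this] have "\<delta> \<le> norm (\<Sum>b\<in>B. (1 / M) *\<^sub>R (?r x b *\<^sub>R b))"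
      by simp
    also have "\<dots> = norm x / M"
      unfolding scaleR_sum_right[symmetric] expand using \<open>0 < M\<close> by simp
    finally have "M \<le> norm x / \<delta>"
      using \<open>0 < M\<close> \<delta>(1) by (simp add: field_simps)
    then show ?thesis using M[OF \<open>b \<in> B\<close>] by simp
  qed
  then show ?thesis using that[of "1 / \<delta>"] \<delta>(1) by simp
qed

lemma finite_dim_coordinates:
  assumes "finite_dim (UNIV :: 'a::real_normed_vector set)"
  obtains B :: "'a::real_normed_vector set" and coord :: "'a \<Rightarrow> 'a \<Rightarrow>\<^sub>L real"
  where "finite B" "\<And>x. (\<Sum>b\<in>B. blinfun_apply (coord b) x *\<^sub>R b) = x"
proof -
  obtain B0 :: "'a set" where B0: "finite B0" "span B0 = UNIV"
    using assms unfolding finite_dim_def by auto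
  obtain B where B: "B \<subseteq> B0" "independent B" "B0 \<subseteq> span B"
    by (rule real_vector.maximal_independent_subset)
  have fin: "finite B" using B(1) B0(1) by (rule finite_subset)
  have sp: "span B = UNIV"
    using B(3) B0(2) by (metis span_mono span_span top.extremum_uniqueI)
  obtain K where K: "0 \<le> K" "\<And>x b. \<bar>representation B x b\<bar> \<le> K * norm x"
    using finite_dim_representation_bounded[OF fin B(2) sp] by blast
  have bl: "bounded_linear (\<lambda>x. representation B x b)" for b
    by (rule bounded_linear_intro[where K = K])
       (use B(2) sp K(2) in \<open>auto simp: real_vector.representation_add real_vector.representation_scale
          mult.commute\<close>)
  show ?thesis
  proof (rule that[OF fin])
    show "(\<Sum>b\<in>B. blinfun_apply (Blinfun (\<lambda>x. representation B x b)) x *\<^sub>R b) = x" for x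
      unfolding bounded_linear_Blinfun_apply[OF bl]
      by (rule real_vector.sum_representation_eq) (use B sp fin in auto)
  qed
qed

lemma finite_dim_linear_bounded:
  fixes f :: "'a::real_normed_vector \<Rightarrow> 'b::real_normed_vector"
  assumes "finite_dim (UNIV :: 'a set)" "linear f"
  shows "bounded_linear f"
proof -
  obtain B :: "'a set" and coord :: "'a \<Rightarrow> 'a \<Rightarrow>\<^sub>L real"
    where B: "\<And>x. (\<Sum>b\<in>B. blinfun_apply (coord b) x *\<^sub>R b) = x"
    using finite_dim_coordinates[OF assms(1)] by metis
  have "f = (\<lambda>x. \<Sum>b\<in>B. blinfun_apply (coord b) x *\<^sub>R f b)"
  proof
    fix x
    have "f x = f (\<Sum>b\<in>B. blinfun_apply (coord b) x *\<^sub>R b)" by (simp add: B)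
    then show "f x = (\<Sum>b\<in>B. blinfun_apply (coord b) x *\<^sub>R f b)"
      by (simp add: linear_sum[OF assms(2)] linear_scale[OF assms(2)])
  qed
  moreover have "bounded_linear (\<lambda>x. \<Sum>b\<in>B. blinfun_apply (coord b) x *\<^sub>R f b)"
    by (intro bounded_linear_sum bounded_linear_scaleR_const blinfun.bounded_linear_right)
  ultimately show ?thesis by simp
qed

text \<open>
  The Heine-Borel property. Bounded coordinates exhibit the set as a closed part of a continuous image of a
  product of intervals.
\<close>
lemma finite_dim_compact:
  fixes K :: "'a::real_normed_vector set"
  assumes "finite_dim (UNIV :: 'a set)" "bounded K" "closed K"
  shows "compact K"
proof -
  obtain B :: "'a set" and coord :: "'a \<Rightarrow> 'a \<Rightarrow>\<^sub>L real"
    where B: "finite B" "\<And>x. (\<Sum>b\<in>B. blinfun_apply (coord b) x *\<^sub>R b) = x"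
    using finite_dim_coordinates[OF assms(1)] by metis
  obtain R where R: "\<And>x. x \<in> K \<Longrightarrow> norm x \<le> R"
    using assms(2) unfolding bounded_iff by blast
  define X where "X = {c :: 'a \<Rightarrow> real. \<forall>b. c b \<in> {- (norm (coord b) * R)..norm (coord b) * R}}"
  have "K \<subseteq> (\<lambda>c. \<Sum>b\<in>B. c b *\<^sub>R b) ` X"
  proof
    fix x assume "x \<in> K"
    have "\<bar>blinfun_apply (coord b) x\<bar> \<le> norm (coord b) * R" for b
      using norm_blinfun[of "coord b" x] mult_left_mono[OF R[OF \<open>x \<in> K\<close>], of "norm (coord b)"]
      by simp
    then have "(\<lambda>b. blinfun_apply (coord b) x) \<in> X"
      by (simp add: X_def abs_le_iff) (metis minus_le_iff)
    then show "x \<in> (\<lambda>c. \<Sum>b\<in>B. c b *\<^sub>R b) ` X"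
      by (rule rev_image_eqI) (simp add: B)
  qed
  moreover have "compact ((\<lambda>c. \<Sum>b\<in>B. c b *\<^sub>R b) ` X)"
    unfolding X_def by (intro compact_continuous_image continuous_on_lincomb compact_Pi_UNIV) simp
  ultimately show ?thesis
    using assms(3) by (metis closed_Int_compact inf.absorb1)
qed

text \<open>
  The criterion by which the spaces of maps and forms below are recognised as finite-dimensional: no basis
  has to be exhibited, only finitely many functionals whose common kernel is trivial. Each functional cuts
  the dimension down by at most one, which gives the induction step.
\<close>
lemma finite_dim_separating_functionals:
  assumes "finite I" "\<And>i. i \<in> I \<Longrightarrow> linear (F i :: 'a::real_vector \<Rightarrow> real)" "subspace V"
    and "\<And>x. x \<in> V \<Longrightarrow> (\<And>i. i \<in> I \<Longrightarrow> F i x = 0) \<Longrightarrow> x = 0"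
  shows "finite_dim V"
  using assms
proof (induction I arbitrary: V rule: finite_induct)
  case empty
  then have "V \<subseteq> span {}" by auto
  then show ?case unfolding finite_dim_def by blast
next
  case (insert i I)
  have lin: "linear (F i)" using insert.prems(1) by simp
  define W where "W = V \<inter> {x. F i x = 0}"
  have "finite_dim W"
  proof (rule insert.IH)
    show "subspace W"
      unfolding W_def using insert.prems(2) linear_subspace_kernel[OF lin] by (rule subspace_inter)
    show "linear (F j)" if "j \<in> I" for j
      using that by (intro insert.prems(1)) simp
    show "x = 0" if "x \<in> W" "\<And>j. j \<in> I \<Longrightarrow> F j x = 0" for x
      using that by (intro insert.prems(3)) (auto simp: W_def)
  qed
  then obtain B where B: "finite B" "W \<subseteq> span B" unfolding finite_dim_def by blast
  show ?case
  proof (cases "\<exists>s\<in>V. F i s \<noteq> 0")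
    case False
    then have "V = W" by (auto simp: W_def)
    then show ?thesis using \<open>finite_dim W\<close> by simp
  next
    case True
    then obtain s where s: "s \<in> V" "F i s \<noteq> 0" by blast
    have "x \<in> span (insert s B)" if "x \<in> V" for x
    proof -
      have "x - (F i x / F i s) *\<^sub>R s \<in> W"
        using that s insert.prems(2)
        by (simp add: W_def linear_diff[OF lin] linear_scale[OF lin] subspace_diff subspace_scale)
      then have "x - (F i x / F i s) *\<^sub>R s \<in> span B" using B(2) by blast
      then show ?thesis unfolding real_vector.span_insert by blast
    qed
    then show ?thesis unfolding finite_dim_def using B(1) by (intro exI[of _ "insert s B"]) auto
  qed
qed

lemma finite_dim_blinfun:
  assumes "finite_dim (UNIV :: 'a::real_normed_vector set)"
    and "finite_dim (UNIV :: 'b::real_normed_vector set)"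
  shows "finite_dim (UNIV :: ('a \<Rightarrow>\<^sub>L 'b) set)"
proof -
  obtain B :: "'a set" and coord :: "'a \<Rightarrow> 'a \<Rightarrow>\<^sub>L real"
    where B: "finite B" "\<And>x. (\<Sum>b\<in>B. blinfun_apply (coord b) x *\<^sub>R b) = x"
    using finite_dim_coordinates[OF assms(1)] by metis
  obtain B' :: "'b set" and coord' :: "'b \<Rightarrow> 'b \<Rightarrow>\<^sub>L real"
    where B': "finite B'" "\<And>x. (\<Sum>b\<in>B'. blinfun_apply (coord' b) x *\<^sub>R b) = x"
    using finite_dim_coordinates[OF assms(2)] by metis
  show ?thesis
  proof (rule finite_dim_separating_functionals[where I = "B \<times> B'"
        and F = "\<lambda>(b, b') f. blinfun_apply (coord' b') (blinfun_apply f b)"])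
    fix f :: "'a \<Rightarrow>\<^sub>L 'b"
    assume "\<And>i. i \<in> B \<times> B' \<Longrightarrow>
      (case i of (b, b') \<Rightarrow> \<lambda>f. blinfun_apply (coord' b') (blinfun_apply f b)) f = 0"
    then have zero: "blinfun_apply (coord' b') (blinfun_apply f b) = 0" if "b \<in> B" "b' \<in> B'" for b b'
      using that by force
    have fb: "blinfun_apply f b = 0" if "b \<in> B" for b
      using B'(2)[of "blinfun_apply f b"] zero[OF that] by simp
    show "f = 0"
    proof (rule blinfun_eqI)
      fix x
      have "blinfun_apply f x = blinfun_apply f (\<Sum>b\<in>B. blinfun_apply (coord b) x *\<^sub>R b)"
        by (simp add: B)
      also have "\<dots> = 0"
        by (simp add: blinfun.sum_right blinfun.scaleR_right fb)
      finally show "blinfun_apply f x = blinfun_apply 0 x" by simp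
    qed
  qed (use B B' in \<open>auto simp: linear_iff blinfun.bilinear_simps\<close>)
qed

lemma finite_dim_real: "finite_dim (UNIV :: real set)"
proof -
  have "x \<in> span {1}" for x :: real
    using span_scale[OF span_base[of 1 "{1::real}"], of x] by simp
  then show ?thesis unfolding finite_dim_def by (intro exI[of _ "{1}"]) auto
qed

text \<open>
  Multilinearity lets the arguments be moved from the spanning set to arbitrary vectors one index at a time;
  \<open>J\<close> in the proof is the set of indices already freed.
\<close>
lemma sym_form_zero_on_span:
  fixes m :: "('n::finite, 'a::real_normed_vector) sym_form"
  assumes zero: "\<And>v. (\<And>i. v i \<in> B) \<Longrightarrow> sym_form_apply m v = 0"
    and sp: "span B = UNIV"
  shows "m = 0"
proof (rule sym_form_eqI)
  have "sym_form_apply m v = 0" if "finite J" "\<And>i. i \<notin> J \<Longrightarrow> v i \<in> B" for J v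
    using that
  proof (induction J arbitrary: v)
    case empty
    then show ?case using zero by simp
  next
    case (insert j J)
    have "sym_form_apply m (v(j := x)) = 0" if "x \<in> B" for x
      by (rule insert.IH) (use insert.prems that in auto)
    then have "sym_form_apply m (v(j := v j)) = 0"
      by (rule linear_eq_0_on_span[OF is_sym_form_linear[OF is_sym_form_apply]]) (use sp in auto)
    then show ?case by simp
  qed
  from this[of UNIV] show "sym_form_apply m v = sym_form_apply 0 v" for v
    by (simp add: zero_sym_form.rep_eq)
qed

lemma finite_dim_sym_form:
  assumes "finite_dim (UNIV :: 'a::real_normed_vector set)"
  shows "finite_dim (UNIV :: ('n::finite, 'a) sym_form set)"
proof -
  obtain B :: "'a set" where B: "finite B" "span B = UNIV"
    using assms unfolding finite_dim_def by auto
  show ?thesis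
  proof (rule finite_dim_separating_functionals[where I = "PiE UNIV (\<lambda>_::'n. B)"
        and F = "\<lambda>v m. sym_form_apply m v"])
    show "finite (PiE UNIV (\<lambda>_::'n. B))" using B(1) by (intro finite_PiE) auto
    show "m = 0" if "\<And>i. i \<in> PiE UNIV (\<lambda>_. B) \<Longrightarrow> sym_form_apply m i = 0"
      for m :: "('n, 'a) sym_form"
      by (rule sym_form_zero_on_span[OF that B(2)]) (simp add: PiE_def)
  qed (auto intro: bounded_linear.linear[OF bounded_linear_sym_form_apply])
qed

section \<open>Convex cones in finite dimension\<close>

lemma convex_cone_hull_finite_combination:
  assumes "x \<in> convex_cone hull S"
  obtains T u where "finite T" "T \<subseteq> S" "\<And>v. v \<in> T \<Longrightarrow> 0 \<le> u v" "(\<Sum>v\<in>T. u v *\<^sub>R v) = x"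
proof (cases "S = {}")
  case True
  then show ?thesis using that[of "{}"] assms by simp
next
  case False
  then obtain c y where c: "0 \<le> c" "y \<in> convex hull S" "x = c *\<^sub>R y"
    using assms unfolding convex_cone_hull_separate_nonempty[OF False] conic_hull_explicit by blast
  then obtain T u where T: "finite T" "T \<subseteq> S" "\<forall>v\<in>T. 0 \<le> u v" "(\<Sum>v\<in>T. u v *\<^sub>R v) = y"
    unfolding convex_hull_explicit by blast
  show ?thesis
    by (rule that[of T "\<lambda>v. c * u v"]) (use T c in \<open>auto simp: scaleR_sum_right\<close>)
qed

text \<open>
  Caratheodory's theorem for cones. In a representation with the least number of generators, a linear
  dependence \<open>w\<close> among them could be subtracted in the multiple \<open>r\<close> that keeps all
  coefficients nonnegative and makes one of them vanish, contradicting minimality.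
\<close>
lemma conic_caratheodory:
  assumes x: "x \<in> convex_cone hull S"
  obtains T u where "finite T" "T \<subseteq> S" "independent T" "\<And>v. v \<in> T \<Longrightarrow> 0 \<le> u v"
    "(\<Sum>v\<in>T. u v *\<^sub>R v) = x"
proof -
  define P where "P n \<longleftrightarrow> (\<exists>T u. finite T \<and> T \<subseteq> S \<and> card T = n \<and> (\<forall>v\<in>T. 0 \<le> u v) \<and>
    (\<Sum>v\<in>T. u v *\<^sub>R v) = x)" for n
  have "\<exists>n. P n"
    by (rule convex_cone_hull_finite_combination[OF x]) (auto simp: P_def)
  define n where "n = (LEAST n. P n)"
  have "P n" and least: "\<And>k. k < n \<Longrightarrow> \<not> P k"
    using \<open>\<exists>n. P n\<close> unfolding n_def by (auto intro: LeastI dest: not_less_Least)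
  then obtain T u where T: "finite T" "T \<subseteq> S" "card T = n" "\<And>v. v \<in> T \<Longrightarrow> 0 \<le> u v"
    "(\<Sum>v\<in>T. u v *\<^sub>R v) = x"
    unfolding P_def by blast
  have "independent T"
  proof (rule ccontr)
    assume "\<not> independent T"
    then obtain w0 where w0: "(\<Sum>v\<in>T. w0 v *\<^sub>R v) = 0" "\<exists>v\<in>T. w0 v \<noteq> 0"
      using real_vector.dependent_finite[OF T(1)] by blast
    obtain w where w: "(\<Sum>v\<in>T. w v *\<^sub>R v) = 0" "\<exists>v\<in>T. 0 < w v"
    proof (cases "\<exists>v\<in>T. 0 < w0 v")
      case True
      then show ?thesis using that w0 by blast
    next
      case False
      then have "\<exists>v\<in>T. 0 < - w0 v" using w0(2) by (metis neg_0_less_iff_less linorder_neqE)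
      then show ?thesis using that[of "\<lambda>v. - w0 v"] w0(1) by (simp add: sum_negf)
    qed
    let ?Q = "{v \<in> T. 0 < w v}"
    have Q: "finite ?Q" "?Q \<noteq> {}" using T(1) w(2) by auto
    then have "Min ((\<lambda>v. u v / w v) ` ?Q) \<in> (\<lambda>v. u v / w v) ` ?Q"
      by (intro Min_in) auto
    then obtain v0 where v0: "v0 \<in> ?Q" "Min ((\<lambda>v. u v / w v) ` ?Q) = u v0 / w v0"
      by blast
    have v0_min: "u v0 / w v0 \<le> u v / w v" if "v \<in> ?Q" for v
      unfolding v0(2)[symmetric] using Q(1) that by (intro Min_le) auto
    define r where "r = u v0 / w v0"
    have r: "0 \<le> r" unfolding r_def using v0(1) T(4) by auto
    have nonneg: "0 \<le> u v - r * w v" if "v \<in> T" for v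
    proof (cases "0 < w v")
      case True
      then show ?thesis using v0_min[of v] that by (simp add: r_def[symmetric] field_simps)
    next
      case False
      then have "r * w v \<le> 0" using r by (simp add: mult_nonneg_nonpos)
      then show ?thesis using T(4)[OF that] by simp
    qed
    have "(\<Sum>v\<in>T - {v0}. (u v - r * w v) *\<^sub>R v) = (\<Sum>v\<in>T. (u v - r * w v) *\<^sub>R v)"
      by (rule sum.mono_neutral_left) (use T(1) v0(1) in \<open>auto simp: r_def\<close>)
    also have "\<dots> = (\<Sum>v\<in>T. u v *\<^sub>R v) - r *\<^sub>R (\<Sum>v\<in>T. w v *\<^sub>R v)"
      by (simp add: scaleR_diff_left sum_subtractf scaleR_sum_right)
    also have "\<dots> = x" by (simp add: T(5) w(1))
    finally have "P (card (T - {v0}))"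
      unfolding P_def using T(1,2) nonneg
      by (intro exI[of _ "T - {v0}"] exI[of _ "\<lambda>v. u v - r * w v"]) auto
    moreover have "card (T - {v0}) < n"
      using T(1,3) v0(1) by (metis (no_types, lifting) card_Diff1_less mem_Collect_eq)
    ultimately show False using least by blast
  qed
  then show ?thesis using that T by blast
qed

text \<open>
  This is what makes the tensor and symmetric cones closed. A functional \<open>\<phi>\<close> that is
  positive on the compact set \<open>S\<close> is bounded below there by some \<open>\<delta> > 0\<close>,
  hence controls the coefficients: on the part of the cone with \<open>\<phi> < K\<close> they are at most
  \<open>K / \<delta>\<close>. By Caratheodory the number of terms is bounded by the size of a spanning set,
  so this part of the cone lies in the compact set \<open>D K\<close>, and \<open>D K\<close> lies in the
  cone.
\<close>
lemma closed_convex_cone_hull_compact: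
  fixes S :: "'a::real_normed_vector set" and \<phi> :: "'a \<Rightarrow> real"
  assumes fd: "finite_dim (UNIV :: 'a set)" and S: "compact S" and \<phi>: "bounded_linear \<phi>"
    and pos: "\<And>s. s \<in> S \<Longrightarrow> 0 < \<phi> s"
  shows "closed (convex_cone hull S)"
proof (cases "S = {}")
  case True
  then show ?thesis by simp
next
  case False
  then obtain s0 where "s0 \<in> S" by blast
  obtain B :: "'a set" where B: "finite B" "span B = UNIV"
    using fd unfolding finite_dim_def by auto
  have lin: "linear \<phi>" using \<phi> by (rule bounded_linear.linear)
  let ?N = "card B" and ?C = "convex_cone hull S"
  obtain \<delta> where \<delta>: "0 < \<delta>" "\<And>s. s \<in> S \<Longrightarrow> \<delta> \<le> \<phi> s"
    using compact_gauge_bound[OF S linear_continuous_on[OF \<phi>] pos] by blast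
  define comb where "comb = (\<lambda>p :: nat \<Rightarrow> real \<times> 'a. \<Sum>i<?N. fst (p i) *\<^sub>R snd (p i))"
  define D where "D K = comb ` {p. \<forall>i. p i \<in> {0..K / \<delta>} \<times> S}" for K
  have "continuous_on X comb" for X
    unfolding comb_def
    by (intro continuous_intros continuous_on_subset[OF continuous_on_product_coordinates]) auto
  then have "compact (D K)" for K
    unfolding D_def by (intro compact_continuous_image compact_Pi_UNIV compact_Times S) auto
  then have "closed (D K)" for K by (rule compact_imp_closed)
  have D_sub: "D K \<subseteq> ?C" for K
  proof
    fix y assume "y \<in> D K"
    then obtain p where p: "\<And>i. p i \<in> {0..K / \<delta>} \<times> S" "y = (\<Sum>i<?N. fst (p i) *\<^sub>R snd (p i))"
      unfolding D_def comb_def by blast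
    have in_C: "fst (p i) *\<^sub>R snd (p i) \<in> ?C" for i
      using p(1)[of i] by (intro convex_cone_hull_mul hull_inc) (auto simp: mem_Times_iff)
    have "(\<Sum>i\<in>F. fst (p i) *\<^sub>R snd (p i)) \<in> ?C" for F
      by (induction F rule: infinite_finite_induct)
         (auto intro: convex_cone_hull_contains_0 convex_cone_hull_add in_C)
    then show "y \<in> ?C" by (simp add: p(2))
  qed
  have C_sub: "y \<in> D K" if yC: "y \<in> ?C" and yK: "\<phi> y < K" for y K
  proof -
    obtain T u where T: "finite T" "T \<subseteq> S" "independent T" "\<And>v. v \<in> T \<Longrightarrow> 0 \<le> u v"
      "(\<Sum>v\<in>T. u v *\<^sub>R v) = y"
      using conic_caratheodory[OF yC] by blast
    have card: "card T \<le> ?N"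
      using real_vector.independent_span_bound[OF B(1) T(3)] B(2) by auto
    obtain e where e: "bij_betw e {..<card T} T"
      using ex_bij_betw_nat_finite[OF T(1)] by (auto simp: atLeast0LessThan)
    have \<phi>0: "0 \<le> \<phi> v" if "v \<in> T" for v
      using pos[of v] that T(2) by (auto intro: less_imp_le)
    have u: "u v \<in> {0..K / \<delta>}" if "v \<in> T" for v
    proof -
      have "u v * \<delta> \<le> u v * \<phi> v"
        using that T(2,4) \<delta>(2) by (intro mult_left_mono) auto
      also have "\<dots> \<le> (\<Sum>v\<in>T. u v * \<phi> v)"
        using that T(1,4) \<phi>0 by (intro member_le_sum) auto
      also have "\<dots> = \<phi> y"
        by (simp add: T(5)[symmetric] linear_sum[OF lin] linear_scale[OF lin])
      finally show ?thesis
        using yK \<delta>(1) T(4)[OF that] by (simp add: field_simps)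
    qed
    have K: "0 \<le> K / \<delta>"
    proof -
      have "0 \<le> (\<Sum>v\<in>T. u v * \<phi> v)"
        using T(4) \<phi>0 by (intro sum_nonneg mult_nonneg_nonneg) auto
      also have "\<dots> = \<phi> y"
        by (simp add: T(5)[symmetric] linear_sum[OF lin] linear_scale[OF lin])
      finally show ?thesis using yK \<delta>(1) by simp
    qed
    \<comment> \<open>Combinations of fewer than \<open>?N\<close> vectors are padded with zero multiples of \<open>s0\<close>.\<close>
    define p where "p i = (if i < card T then (u (e i), e i) else (0, s0))" for i
    have "comb p = (\<Sum>i<card T. u (e i) *\<^sub>R e i)"
      unfolding comb_def using card
      by (intro sum.mono_neutral_cong_right) (auto simp: p_def)
    also have "\<dots> = y"
      using sum.reindex_bij_betw[OF e, of "\<lambda>v. u v *\<^sub>R v"] T(5) by simp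
    finally have "comb p = y" .
    moreover have "p i \<in> {0..K / \<delta>} \<times> S" for i
    proof (cases "i < card T")
      case True
      then have "e i \<in> T" using e by (auto simp: bij_betw_def)
      then show ?thesis using u[of "e i"] T(2) True by (auto simp: p_def)
    next
      case False
      then show ?thesis using K \<open>s0 \<in> S\<close> by (simp add: p_def)
    qed
    ultimately show ?thesis unfolding D_def by blast
  qed
  \<comment> \<open>Near \<open>y\<close> the cone agrees with its part where \<open>\<phi> < \<phi> y + 1\<close>, so \<open>y\<close> lies in the closed set \<open>D (\<phi> y + 1)\<close>.\<close>
  have "y \<in> ?C" if "y \<in> closure ?C" for y
  proof -
    let ?K = "\<phi> y + 1" and ?U = "{z. \<phi> z < \<phi> y + 1}"
    have "open ?U" by (intro open_Collect_less continuous_intros linear_continuous_on[OF \<phi>])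
    then have "?U \<inter> closure ?C \<subseteq> closure (?U \<inter> ?C)" by (rule open_Int_closure_subset)
    also have "\<dots> \<subseteq> D ?K"
      by (rule closure_minimal) (use C_sub \<open>closed (D ?K)\<close> in auto)
    finally have sub: "?U \<inter> closure ?C \<subseteq> D ?K" .
    have "y \<in> ?U \<inter> closure ?C" using that by simp
    then show ?thesis using sub D_sub[of ?K] by blast
  qed
  then show ?thesis using closure_subset_eq by blast
qed

text \<open>
  The first-order condition at a minimum: the linear term dominates for small \<open>t\<close>.
\<close>
lemma nonneg_of_quadratic:
  fixes a b :: real
  assumes "\<And>t. 0 < t \<Longrightarrow> t \<le> 1 \<Longrightarrow> 0 \<le> 2 * t * a + t\<^sup>2 * b"
  shows "0 \<le> a"
proof (rule ccontr)
  assume "\<not> 0 \<le> a"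
  define t where "t = min 1 (- a / (\<bar>b\<bar> + 1))"
  have t: "0 < t" "t \<le> 1" unfolding t_def using \<open>\<not> 0 \<le> a\<close> by (auto intro: divide_neg_pos)
  have "0 \<le> t * (2 * a + t * b)"
    using assms[OF t] by (simp add: power2_eq_square algebra_simps)
  then have "0 \<le> 2 * a + t * b" using t(1) by (simp add: zero_le_mult_iff)
  moreover have "t * b \<le> t * (\<bar>b\<bar> + 1)" using t(1) by (intro mult_left_mono) auto
  moreover have "t * (\<bar>b\<bar> + 1) \<le> - a"
  proof -
    have "t \<le> - a / (\<bar>b\<bar> + 1)" unfolding t_def by simp
    then show ?thesis by (subst (asm) pos_le_divide_eq) auto
  qed
  ultimately show False using \<open>\<not> 0 \<le> a\<close> by linarith
qed

text \<open>
  Coordinates induce an inner product \<open>ip\<close>. If \<open>y0\<close> is the point of the cone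
  nearest to \<open>x\<close> and \<open>n = x - y0\<close>, then moving from \<open>y0\<close> in the
  direction of any point of the cone cannot decrease the distance, so \<open>n\<close> has nonpositive
  product with the cone; shrinking \<open>y0\<close> cannot decrease it either, so \<open>n\<close> is
  orthogonal to \<open>y0\<close> and \<open>ip n x = ip n n > 0\<close>. The separating functional is
  \<open>- ip n\<close>.
\<close>
lemma closed_convex_cone_separation:
  fixes A :: "'a::real_normed_vector set"
  assumes fd: "finite_dim (UNIV :: 'a set)" and A: "convex_cone A" "closed A" and x: "x \<notin> A"
  obtains \<phi> :: "'a \<Rightarrow>\<^sub>L real" where "\<forall>y\<in>A. 0 \<le> blinfun_apply \<phi> y" "blinfun_apply \<phi> x < 0"
proof -
  obtain B :: "'a set" and coord :: "'a \<Rightarrow> 'a \<Rightarrow>\<^sub>L real"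
    where B: "finite B" "\<And>x. (\<Sum>b\<in>B. blinfun_apply (coord b) x *\<^sub>R b) = x"
    using finite_dim_coordinates[OF fd] by metis
  define ip where "ip u v = (\<Sum>b\<in>B. blinfun_apply (coord b) u * blinfun_apply (coord b) v)" for u v
  have ip_lin: "ip (u + u') v = ip u v + ip u' v" "ip u (v + v') = ip u v + ip u v'"
    "ip (c *\<^sub>R u) v = c * ip u v" "ip u (c *\<^sub>R v) = c * ip u v"
    "ip (u - u') v = ip u v - ip u' v" "ip u (v - v') = ip u v - ip u v'" for u u' v v' c
    by (simp_all add: ip_def blinfun.bilinear_simps algebra_simps sum.distrib sum_subtractf
        sum_distrib_left)
  have ip_sym: "ip u v = ip v u" for u v by (simp add: ip_def mult.commute)
  have ip_nonneg: "0 \<le> ip u u" for u by (simp add: ip_def sum_nonneg)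
  have coord_le: "\<bar>blinfun_apply (coord b) u\<bar> \<le> sqrt (ip u u)" if "b \<in> B" for b u
  proof -
    have "(blinfun_apply (coord b) u)\<^sup>2 \<le> ip u u"
      unfolding ip_def power2_eq_square using that B(1)
      by (intro member_le_sum[of b B "\<lambda>b. blinfun_apply (coord b) u * blinfun_apply (coord b) u"]) auto
    then show ?thesis using real_le_rsqrt[of "\<bar>blinfun_apply (coord b) u\<bar>"] by simp
  qed
  have norm_le: "norm u \<le> (\<Sum>b\<in>B. norm b) * sqrt (ip u u)" for u
  proof -
    have "norm u = norm (\<Sum>b\<in>B. blinfun_apply (coord b) u *\<^sub>R b)" by (simp add: B)
    also have "\<dots> \<le> (\<Sum>b\<in>B. \<bar>blinfun_apply (coord b) u\<bar> * norm b)"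
      by (rule order_trans[OF norm_sum]) simp
    also have "\<dots> \<le> (\<Sum>b\<in>B. sqrt (ip u u) * norm b)"
      by (intro sum_mono mult_right_mono coord_le) auto
    finally show ?thesis by (simp add: sum_distrib_right mult.commute)
  qed
  have ip_cont: "continuous_on X (\<lambda>y. ip (x - y) (x - y))" for X
    unfolding ip_def by (intro continuous_intros)
  \<comment> \<open>The infimum of the distance is not changed by keeping only the points of \<open>A\<close> that are at least as near to \<open>x\<close> as the origin, and these form a compact set.\<close>
  define S where "S = {y \<in> A. ip (x - y) (x - y) \<le> ip x x}"
  have "bounded S"
    unfolding bounded_iff
  proof (intro exI ballI)
    fix y assume "y \<in> S"
    have "norm y \<le> norm x + norm (x - y)" using norm_triangle_ineq4[of x "x - y"] by simp
    also have "norm (x - y) \<le> (\<Sum>b\<in>B. norm b) * sqrt (ip (x - y) (x - y))" by (rule norm_le)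
    also have "\<dots> \<le> (\<Sum>b\<in>B. norm b) * sqrt (ip x x)"
      using \<open>y \<in> S\<close> by (intro mult_left_mono) (auto simp: S_def sum_nonneg)
    finally show "norm y \<le> norm x + (\<Sum>b\<in>B. norm b) * sqrt (ip x x)" by simp
  qed
  moreover have "closed S"
  proof -
    have "S = A \<inter> {y. ip (x - y) (x - y) \<le> ip x x}" by (auto simp: S_def)
    then show ?thesis using A(2) by (auto intro!: closed_Int closed_Collect_le ip_cont continuous_intros)
  qed
  ultimately have "compact S" by (rule finite_dim_compact[OF fd])
  moreover have "S \<noteq> {}"
    using convex_cone_contains_0[OF A(1)] by (auto simp: S_def intro!: exI[of _ 0])
  ultimately obtain y0 where y0: "y0 \<in> S" "\<And>y. y \<in> S \<Longrightarrow> ip (x - y0) (x - y0) \<le> ip (x - y) (x - y)"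
    using continuous_attains_inf[OF _ _ ip_cont] by metis
  have y0A: "y0 \<in> A" using y0(1) by (simp add: S_def)
  have min: "ip (x - y0) (x - y0) \<le> ip (x - y) (x - y)" if "y \<in> A" for y
    using y0 that unfolding S_def by (smt (verit) mem_Collect_eq)
  define n where "n = x - y0"
  have le: "ip n z \<le> 0" if "z \<in> A" for z
  proof -
    have "0 \<le> 2 * t * (- ip n z) + t\<^sup>2 * ip z z" if "0 < t" for t
    proof -
      have "y0 + t *\<^sub>R z \<in> A"
        using A(1) y0A \<open>z \<in> A\<close> that by (intro convex_cone_add convex_cone_scaleR) auto
      from min[OF this] show ?thesis
        using ip_sym[of z n] by (simp add: n_def[symmetric] diff_diff_eq[symmetric] ip_lin power2_eq_square
            algebra_simps)
    qed
    then show ?thesis using nonneg_of_quadratic[of "- ip n z" "ip z z"] by auto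
  qed
  have ge: "0 \<le> ip n y0"
  proof (rule nonneg_of_quadratic)
    fix t :: real assume t: "0 < t" "t \<le> 1"
    have "(1 - t) *\<^sub>R y0 \<in> A" using A(1) y0A t by (intro convex_cone_scaleR) auto
    moreover have "x - (1 - t) *\<^sub>R y0 = n + t *\<^sub>R y0" by (simp add: n_def algebra_simps)
    ultimately show "0 \<le> 2 * t * ip n y0 + t\<^sup>2 * ip y0 y0"
      using min[of "(1 - t) *\<^sub>R y0"] ip_sym[of y0 n]
      by (simp add: n_def[symmetric] ip_lin power2_eq_square algebra_simps)
  qed
  have "n \<noteq> 0" using y0A x by (auto simp: n_def)
  then have "0 < ip n n" using norm_le[of n] ip_nonneg[of n] by (cases "ip n n = 0") auto
  moreover have "ip n x = ip n n + ip n y0" by (simp add: ip_lin(2)[symmetric]) (simp add: n_def)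
  ultimately have pos: "0 < ip n x" using ge by simp
  have bl: "bounded_linear (\<lambda>z. - ip n z)"
    unfolding ip_def
    by (intro bounded_linear_minus bounded_linear_sum bounded_linear_mult_const
        bounded_linear_const_mult blinfun.bounded_linear_right)
  show ?thesis
    by (rule that[of "Blinfun (\<lambda>z. - ip n z)"])
       (use le pos in \<open>simp_all add: bounded_linear_Blinfun_apply[OF bl]\<close>)
qed

lemma convex_cone_closure:
  fixes A :: "'a::real_normed_vector set"
  assumes "convex_cone A"
  shows "convex_cone (closure A)"
  unfolding convex_cone_iff
proof (intro conjI ballI allI impI)
  show "0 \<in> closure A" using closure_subset convex_cone_contains_0[OF assms] by blast
next
  fix x y assume "x \<in> closure A" "y \<in> closure A"
  then obtain u v where u: "\<And>n. u n \<in> A" "u \<longlonglongrightarrow> x" and v: "\<And>n. v n \<in> A" "v \<longlonglongrightarrow> y"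
    unfolding closure_sequential by blast
  show "x + y \<in> closure A"
    unfolding closure_sequential
    by (intro exI[of _ "\<lambda>n. u n + v n"] conjI allI convex_cone_add[OF assms] tendsto_add u v)
next
  fix x and c :: real assume "x \<in> closure A" "0 \<le> c"
  then obtain u where u: "\<And>n. u n \<in> A" "u \<longlonglongrightarrow> x"
    unfolding closure_sequential by blast
  show "c *\<^sub>R x \<in> closure A"
    unfolding closure_sequential
    by (intro exI[of _ "\<lambda>n. c *\<^sub>R u n"] conjI allI convex_cone_scaleR[OF assms \<open>0 \<le> c\<close>]
        tendsto_scaleR tendsto_const u)
qed

lemma finite_dim_double_dual:
  fixes \<psi> :: "('a::real_normed_vector \<Rightarrow>\<^sub>L real) \<Rightarrow>\<^sub>L real"
  assumes "finite_dim (UNIV :: 'a set)"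
  obtains x where "\<And>\<phi>. blinfun_apply \<psi> \<phi> = blinfun_apply \<phi> x"
proof -
  obtain B :: "'a set" and coord :: "'a \<Rightarrow> 'a \<Rightarrow>\<^sub>L real"
    where B: "\<And>x. (\<Sum>b\<in>B. blinfun_apply (coord b) x *\<^sub>R b) = x"
    using finite_dim_coordinates[OF assms] by metis
  have expand: "\<phi> = (\<Sum>b\<in>B. blinfun_apply \<phi> b *\<^sub>R coord b)" for \<phi> :: "'a \<Rightarrow>\<^sub>L real"
  proof (rule blinfun_eqI)
    fix x
    have "blinfun_apply \<phi> x = blinfun_apply \<phi> (\<Sum>b\<in>B. blinfun_apply (coord b) x *\<^sub>R b)"
      by (simp add: B)
    then show "blinfun_apply \<phi> x = blinfun_apply (\<Sum>b\<in>B. blinfun_apply \<phi> b *\<^sub>R coord b) x"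
      by (simp add: blinfun.bilinear_simps blinfun.sum_right blinfun.sum_left mult.commute)
  qed
  have "blinfun_apply \<psi> \<phi> = blinfun_apply \<phi> (\<Sum>b\<in>B. blinfun_apply \<psi> (coord b) *\<^sub>R b)" for \<phi>
    by (subst expand[of \<phi>])
       (simp add: blinfun.bilinear_simps blinfun.sum_right blinfun.sum_left mult.commute)
  then show ?thesis by (rule that)
qed

section \<open>Continuity of products\<close>

lemma sym_prod_diff:
  "sym_prod (v(j := x)) - sym_prod (v(j := y)) = sym_prod (v(j := x - y))"
  by (rule blinfun_eqI)
     (simp add: blinfun.diff_left linear_diff[OF is_sym_form_linear[OF is_sym_form_apply]])

lemma norm_sym_prod_le: "norm (sym_prod v) \<le> (\<Prod>i\<in>UNIV. norm (v i))"
proof (rule norm_blinfun_bound)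
  show "norm (blinfun_apply (sym_prod v) m) \<le> (\<Prod>i\<in>UNIV. norm (v i)) * norm m" for m
    using norm_sym_form_bound[of m v] by (simp add: mult.commute)
qed (simp add: prod_nonneg)

text \<open>
  Joint continuity of an \<open>n\<close>-linear map in the product topology. The arguments are moved to
  their limits one index at a time, and each move changes the product by a product with one factor tending
  to 0 and all others convergent.
\<close>
lemma tendsto_sym_prod:
  fixes u :: "'x \<Rightarrow> 'n::finite \<Rightarrow> 'a::real_normed_vector"
  assumes u: "\<And>i. ((\<lambda>k. u k i) \<longlongrightarrow> l i) F"
  shows "((\<lambda>k. sym_prod (u k)) \<longlongrightarrow> sym_prod l) F"
proof -
  have "((\<lambda>k. sym_prod (\<lambda>i. if i \<in> J then u k i else l i)) \<longlongrightarrow> sym_prod l) F"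
    if "finite J" for J
    using that
  proof (induction J rule: finite_induct)
    case empty
    then show ?case by simp
  next
    case (insert j J)
    define w where "w k = (\<lambda>i. if i \<in> J then u k i else l i)" for k
    have w: "((\<lambda>k. ((w k)(j := u k j - l j)) i) \<longlongrightarrow> (l(j := 0)) i) F" for i
      using u[of i] tendsto_diff[OF u[of j] tendsto_const[of "l j"]]
      by (cases "i = j"; cases "i \<in> J") (simp_all add: w_def)
    have "((\<lambda>k. \<Prod>i\<in>UNIV. norm (((w k)(j := u k j - l j)) i)) \<longlongrightarrow>
            (\<Prod>i\<in>UNIV. norm ((l(j := 0)) i))) F"
      by (intro tendsto_prod tendsto_norm w)
    moreover have "(\<Prod>i\<in>UNIV. norm ((l(j := 0)) i)) = 0"
      by (rule prod_zero) auto
    ultimately have "((\<lambda>k. \<Prod>i\<in>UNIV. norm (((w k)(j := u k j - l j)) i)) \<longlongrightarrow> 0) F"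
      by (simp only:)
    then have "((\<lambda>k. sym_prod ((w k)(j := u k j - l j))) \<longlongrightarrow> 0) F"
      by (rule Lim_null_comparison[rotated]) (simp only: norm_sym_prod_le eventually_True)
    then have "((\<lambda>k. sym_prod (w k) + sym_prod ((w k)(j := u k j - l j))) \<longlongrightarrow> sym_prod l + 0) F"
      using insert.IH unfolding w_def by (intro tendsto_add)
    moreover have "sym_prod (w k) + sym_prod ((w k)(j := u k j - l j)) =
        sym_prod (\<lambda>i. if i \<in> insert j J then u k i else l i)" for k
    proof -
      have "(w k)(j := l j) = w k" using insert.hyps(2) by (auto simp: w_def)
      moreover have "(w k)(j := u k j) = (\<lambda>i. if i \<in> insert j J then u k i else l i)"
        by (auto simp: w_def)
      ultimately show ?thesis using sym_prod_diff[of "w k" j "u k j" "l j"] by (simp add: algebra_simps)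
    qed
    ultimately show ?case by simp
  qed
  from this[of UNIV] show ?thesis by simp
qed

lemma continuous_on_sym_prod:
  "continuous_on X (sym_prod :: ('n::finite \<Rightarrow> 'a::real_normed_vector) \<Rightarrow> ('n, 'a) sym_power)"
  unfolding continuous_on_def
proof
  fix v :: "'n \<Rightarrow> 'a" assume "v \<in> X"
  show "(sym_prod \<longlongrightarrow> sym_prod v) (at v within X)"
  proof (rule tendsto_sym_prod[of "\<lambda>w. w"])
    fix i :: 'n
    have "continuous_on X (\<lambda>w :: 'n \<Rightarrow> 'a. w i)"
      by (rule continuous_on_subset[OF continuous_on_product_coordinates]) simp
    then show "((\<lambda>w. w i) \<longlongrightarrow> v i) (at v within X)"
      using \<open>v \<in> X\<close> by (simp add: continuous_on_def)
  qed
qed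

lemma sym_prod_scaleR:
  fixes v :: "'n::finite \<Rightarrow> 'a::real_normed_vector"
  shows "sym_prod (\<lambda>i. c i *\<^sub>R v i) = (\<Prod>i\<in>UNIV. c i) *\<^sub>R sym_prod v"
proof -
  have "sym_prod (\<lambda>i. if i \<in> J then c i *\<^sub>R v i else v i) = (\<Prod>i\<in>J. c i) *\<^sub>R sym_prod v"
    if "finite J" for J
    using that
  proof (induction J rule: finite_induct)
    case (insert j J)
    define w where "w = (\<lambda>i. if i \<in> J then c i *\<^sub>R v i else v i)"
    have "(\<lambda>i. if i \<in> insert j J then c i *\<^sub>R v i else v i) = w(j := c j *\<^sub>R v j)"
      by (auto simp: w_def)
    moreover have "sym_prod (w(j := c j *\<^sub>R v j)) = c j *\<^sub>R sym_prod (w(j := v j))"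
      by (rule blinfun_eqI)
         (simp add: blinfun.scaleR_left linear_scale[OF is_sym_form_linear[OF is_sym_form_apply]])
    moreover have "w(j := v j) = w" using insert.hyps(2) by (auto simp: w_def)
    ultimately show ?case using insert by (simp add: w_def)
  qed simp
  from this[of UNIV] show ?thesis by simp
qed

lemma bounded_bilinear_tensor_prod:
  "bounded_bilinear (tensor_prod :: 'a::real_normed_vector \<Rightarrow> 'b::real_normed_vector \<Rightarrow> _)"
proof
  show "\<exists>K. \<forall>v w. norm (tensor_prod v w :: ('a, 'b) tensor) \<le> norm v * norm w * K"
  proof (intro exI allI)
    fix v :: 'a and w :: 'b
    have "norm (blinfun_apply (tensor_prod v w) b) \<le> norm v * norm w * norm b"
      for b :: "'a \<Rightarrow>\<^sub>L 'b \<Rightarrow>\<^sub>L real"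
    proof -
      have "norm (blinfun_apply (blinfun_apply b v) w) \<le> norm (blinfun_apply b v) * norm w"
        by (rule norm_blinfun)
      also have "\<dots> \<le> (norm b * norm v) * norm w"
        by (intro mult_right_mono norm_blinfun) simp
      finally show ?thesis by (simp add: mult_ac)
    qed
    then show "norm (tensor_prod v w :: ('a, 'b) tensor) \<le> norm v * norm w * 1"
      by (intro norm_blinfun_bound) auto
  qed
qed (auto intro!: blinfun_eqI simp: blinfun.bilinear_simps)

section \<open>Objects of the category\<close>

lemma ac_object_finite_dim: "ac_object (C :: 'a::real_normed_vector set) \<Longrightarrow> finite_dim (UNIV :: 'a::real_normed_vector set)"
  unfolding ac_object_def finite_dim_def by (elim conjE exE) (metis order_refl)

text \<open>
  Positivity away from the apex is the form in which pointedness enters the closedness proofs.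
\<close>
lemma ac_object_pointed:
  assumes "ac_object (C :: 'a::real_normed_vector set)"
  obtains \<phi> :: "'a::real_normed_vector \<Rightarrow>\<^sub>L real" where "\<And>x. x \<in> C \<Longrightarrow> x \<noteq> 0 \<Longrightarrow> 0 < blinfun_apply \<phi> x"
proof -
  obtain \<phi> :: "'a \<Rightarrow> real" where \<phi>: "linear \<phi>" "\<And>x. x \<in> C \<Longrightarrow> 0 \<le> \<phi> x \<and> (\<phi> x = 0 \<longrightarrow> x = 0)"
    using assms unfolding ac_object_def by blast
  have bl: "bounded_linear \<phi>"
    by (rule finite_dim_linear_bounded[OF ac_object_finite_dim[OF assms] \<phi>(1)])
  have "0 < \<phi> x" if "x \<in> C" "x \<noteq> 0" for x
    using \<phi>(2)[OF that(1)] that(2) by linarith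
  then show ?thesis
    by (intro that[of "Blinfun \<phi>"]) (simp only: bounded_linear_Blinfun_apply[OF bl])
qed

lemma ac_object_convex_cone: "ac_object C \<Longrightarrow> convex_cone C"
  and ac_object_closed: "ac_object C \<Longrightarrow> closed C"
  and ac_object_span: "ac_object C \<Longrightarrow> span C = UNIV"
  by (simp_all only: ac_object_def)

lemma ac_object_compact_sphere:
  assumes "ac_object (C :: 'a::real_normed_vector set)"
  shows "compact (C \<inter> sphere 0 1)"
proof (intro finite_dim_compact ac_object_finite_dim[OF assms] closed_Int bounded_Int
      ac_object_closed[OF assms] disjI2)
  show "bounded (sphere (0 :: 'a) 1)" by (rule bounded_subset[OF bounded_cball sphere_cball])
  show "closed (sphere (0 :: 'a) 1)"
    unfolding sphere_def by (intro closed_Collect_eq continuous_intros)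
qed

lemma ac_object_normalize:
  assumes "ac_object C" "x \<in> C" "x \<noteq> 0"
  shows "x /\<^sub>R norm x \<in> C \<inter> sphere 0 1"
  using assms(2,3) by (simp add: convex_cone_scaleR[OF ac_object_convex_cone[OF assms(1)]])

section \<open>Closedness of tensor and symmetric cones\<close>

lemma sym_pairing_nonneg:
  assumes "\<And>i j. 0 \<le> blinfun_apply (\<phi> i) (v j)"
  shows "0 \<le> sym_pairing \<phi> v"
  unfolding sym_pairing_def by (intro divide_nonneg_nonneg sum_nonneg prod_nonneg) (auto simp: assms)

lemma sym_pairing_pos:
  fixes \<phi> :: "'n::finite \<Rightarrow> 'a::real_normed_vector \<Rightarrow>\<^sub>L real"
  assumes "\<And>i j. 0 < blinfun_apply (\<phi> i) (v j)"
  shows "0 < sym_pairing \<phi> v"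
proof -
  have "id permutes (UNIV :: 'n set)" by (rule permutes_id)
  then have ne: "{\<sigma> :: 'n \<Rightarrow> 'n. \<sigma> permutes UNIV} \<noteq> {}" by blast
  show ?thesis
    unfolding sym_pairing_def
    by (intro divide_pos_pos sum_pos prod_pos finite_permutations ne) (auto simp: assms)
qed

text \<open>
  The products of unit vectors of \<open>C\<close> form a compact generating set of the cone, and if
  \<open>\<phi>\<close> is positive on \<open>C - {0}\<close> then pairing with
  \<open>\<phi> \<cdots> \<phi>\<close> is positive on that set.
\<close>
lemma closed_sym_cone:
  fixes C :: "'a::real_normed_vector set"
  assumes C: "ac_object C"
  shows "closed (sym_cone C :: ('n::finite, 'a) sym_power set)"
proof -
  define S :: "('n, 'a) sym_power set"
    where "S = sym_prod ` {v. \<forall>i. v i \<in> C \<inter> sphere 0 1}"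
  have cone: "sym_cone C = convex_cone hull S"
  proof
    show "convex_cone hull S \<subseteq> sym_cone C"
      unfolding sym_cone_def S_def by (intro hull_mono) auto
    have "sym_prod v \<in> convex_cone hull S" if v: "\<forall>i. v i \<in> C" for v
    proof (cases "\<exists>i. v i = 0")
      case True
      then have "sym_prod v = 0"
        by (intro blinfun_eqI) (auto simp: sym_form_apply_zero_arg)
      then show ?thesis by (simp add: convex_cone_hull_contains_0)
    next
      case False
      then have "\<forall>i. v i /\<^sub>R norm (v i) \<in> C \<inter> sphere 0 1"
        using v ac_object_normalize[OF C] by blast
      then have "sym_prod (\<lambda>i. v i /\<^sub>R norm (v i)) \<in> S" unfolding S_def by blast
      then have "(\<Prod>i\<in>UNIV. norm (v i)) *\<^sub>R sym_prod (\<lambda>i. v i /\<^sub>R norm (v i)) \<in> convex_cone hull S"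
        by (intro convex_cone_hull_mul hull_inc prod_nonneg) auto
      then show ?thesis
        using False by (simp add: sym_prod_scaleR[symmetric])
    qed
    then show "sym_cone C \<subseteq> convex_cone hull S"
      unfolding sym_cone_def by (intro hull_minimal convex_cone_convex_cone_hull) auto
  qed
  obtain \<phi> :: "'a \<Rightarrow>\<^sub>L real" where \<phi>: "\<And>x. x \<in> C \<Longrightarrow> x \<noteq> 0 \<Longrightarrow> 0 < blinfun_apply \<phi> x"
    using ac_object_pointed[OF C] by blast
  show ?thesis
    unfolding cone
  proof (rule closed_convex_cone_hull_compact)
    show "finite_dim (UNIV :: ('n, 'a) sym_power set)"
      by (intro finite_dim_blinfun finite_dim_sym_form finite_dim_real ac_object_finite_dim[OF C])
    show "compact S"
      unfolding S_def
      by (intro compact_continuous_image continuous_on_sym_prod compact_Pi_UNIV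
          ac_object_compact_sphere[OF C])
    show "bounded_linear (\<lambda>x :: ('n, 'a) sym_power. blinfun_apply x (covector_sym_prod (\<lambda>_. \<phi>)))"
      by (rule blinfun.bounded_linear_left)
    show "0 < blinfun_apply s (covector_sym_prod (\<lambda>_. \<phi>))" if "s \<in> S" for s
    proof -
      obtain v where v: "\<forall>i. v i \<in> C \<inter> sphere 0 1" "s = sym_prod v"
        using \<open>s \<in> S\<close> unfolding S_def by blast
      have "0 < blinfun_apply \<phi> (v j)" for j
        using v(1)[rule_format, of j] by (intro \<phi>) auto
      then show ?thesis
        unfolding v(2) by (simp add: covector_sym_prod.rep_eq sym_pairing_pos)
    qed
  qed
qed

text \<open>
  As for the symmetric cone: the generating set consists of the tensors of unit vectors, and the positive
  functional is the pairing with \<open>\<phi> \<otimes> \<psi>\<close>.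
\<close>
lemma closed_tensor_cone:
  fixes C :: "'a::real_normed_vector set" and D :: "'b::real_normed_vector set"
  assumes C: "ac_object C" and D: "ac_object D"
  shows "closed (tensor_cone C D)"
proof -
  interpret tp: bounded_bilinear "tensor_prod :: 'a \<Rightarrow> 'b \<Rightarrow> _"
    by (rule bounded_bilinear_tensor_prod)
  define S where "S = (\<lambda>p. tensor_prod (fst p) (snd p)) ` ((C \<inter> sphere 0 1) \<times> (D \<inter> sphere 0 1))"
  have cone: "tensor_cone C D = convex_cone hull S"
  proof
    show "convex_cone hull S \<subseteq> tensor_cone C D"
      unfolding tensor_cone_def S_def by (intro hull_mono) force
    have "tensor_prod c d \<in> convex_cone hull S" if cd: "c \<in> C" "d \<in> D" for c d
    proof (cases "c = 0 \<or> d = 0")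
      case True
      then show ?thesis by (auto simp: tp.zero_left tp.zero_right convex_cone_hull_contains_0)
    next
      case False
      then have "(c /\<^sub>R norm c, d /\<^sub>R norm d) \<in> (C \<inter> sphere 0 1) \<times> (D \<inter> sphere 0 1)"
        using cd ac_object_normalize[OF C] ac_object_normalize[OF D] by blast
      from imageI[OF this, of "\<lambda>p. tensor_prod (fst p) (snd p)"]
      have "tensor_prod (c /\<^sub>R norm c) (d /\<^sub>R norm d) \<in> S" by (simp add: S_def)
      then have "(norm c * norm d) *\<^sub>R tensor_prod (c /\<^sub>R norm c) (d /\<^sub>R norm d) \<in> convex_cone hull S"
        by (intro convex_cone_hull_mul hull_inc) auto
      then show ?thesis
        using False by (simp add: tp.scaleR_left tp.scaleR_right mult.assoc[symmetric])
          (simp add: mult.assoc)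
    qed
    then show "tensor_cone C D \<subseteq> convex_cone hull S"
      unfolding tensor_cone_def by (intro hull_minimal convex_cone_convex_cone_hull) auto
  qed
  obtain \<phi> :: "'a \<Rightarrow>\<^sub>L real" where \<phi>: "\<And>x. x \<in> C \<Longrightarrow> x \<noteq> 0 \<Longrightarrow> 0 < blinfun_apply \<phi> x"
    using ac_object_pointed[OF C] by blast
  obtain \<psi> :: "'b \<Rightarrow>\<^sub>L real" where \<psi>: "\<And>x. x \<in> D \<Longrightarrow> x \<noteq> 0 \<Longrightarrow> 0 < blinfun_apply \<psi> x"
    using ac_object_pointed[OF D] by blast
  show ?thesis
    unfolding cone
  proof (rule closed_convex_cone_hull_compact)
    show "finite_dim (UNIV :: ('a, 'b) tensor set)"
      by (intro finite_dim_blinfun finite_dim_real ac_object_finite_dim[OF C]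
          ac_object_finite_dim[OF D])
    show "compact S"
      unfolding S_def
      by (intro compact_continuous_image tp.continuous_on continuous_intros compact_Times
          ac_object_compact_sphere C D)
    show "bounded_linear (\<lambda>x :: ('a, 'b) tensor. blinfun_apply x (covector_prod \<phi> \<psi>))"
      by (rule blinfun.bounded_linear_left)
    show "0 < blinfun_apply s (covector_prod \<phi> \<psi>)" if "s \<in> S" for s
    proof -
      obtain c d where cd: "c \<in> C \<inter> sphere 0 1" "d \<in> D \<inter> sphere 0 1" "s = tensor_prod c d"
        using \<open>s \<in> S\<close> unfolding S_def by auto
      have "0 < blinfun_apply \<phi> c" "0 < blinfun_apply \<psi> d"
        using cd by (auto intro!: \<phi> \<psi>)
      then show ?thesis by (simp add: cd(3))
    qed
  qed
qed

section \<open>Functoriality and dense images\<close>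

lemma sym_map_apply: "blinfun_apply (blinfun_apply (sym_map f) x) m = blinfun_apply x (sym_form_pullback f m)"
  by (simp add: sym_map_def bounded_linear_Blinfun_apply bounded_linear_sym_form_pullback)

lemma tensor_map_apply:
  "blinfun_apply (blinfun_apply (tensor_map f g) x) b =
     blinfun_apply x (transpose_map g o\<^sub>L (b o\<^sub>L f))"
  by (simp add: tensor_map_def)

lemma convex_cone_vimage:
  "convex_cone D \<Longrightarrow> convex_cone (blinfun_apply f -` D)"
  by (auto simp: convex_cone_iff blinfun.bilinear_simps)

lemma sym_map_ac_hom:
  fixes f :: "'a::real_normed_vector \<Rightarrow>\<^sub>L 'b::real_normed_vector"
  assumes "f \<in> ac_hom A B"
  shows "sym_map f \<in> ac_hom (sym_cone A :: ('n::finite, 'a) sym_power set) (sym_cone B)"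
proof -
  have "(sym_cone A :: ('n, 'a) sym_power set) \<subseteq> blinfun_apply (sym_map f) -` sym_cone B"
    unfolding sym_cone_def[of A]
  proof (rule hull_minimal)
    show "convex_cone (blinfun_apply (sym_map f :: ('n, 'a) sym_power \<Rightarrow>\<^sub>L _) -` sym_cone B)"
      unfolding sym_cone_def by (intro convex_cone_vimage convex_cone_convex_cone_hull)
    show "{sym_prod v :: ('n, 'a) sym_power |v. \<forall>i. v i \<in> A} \<subseteq> blinfun_apply (sym_map f) -` sym_cone B"
    proof (rule subsetI)
      fix x :: "('n, 'a) sym_power" assume "x \<in> {sym_prod v |v. \<forall>i. v i \<in> A}"
      then obtain v where v: "\<forall>i. v i \<in> A" "x = sym_prod v" by blast
      then have "\<forall>i. blinfun_apply f (v i) \<in> B" using assms by (auto simp: ac_hom_def)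
      then show "x \<in> blinfun_apply (sym_map f) -` sym_cone B"
        unfolding v(2) sym_cone_def vimage_eq sym_map_sym_prod by (intro hull_inc) blast
    qed
  qed
  then show ?thesis by (auto simp: ac_hom_def)
qed

lemma tensor_map_ac_hom:
  assumes "f \<in> ac_hom A1 B1" "g \<in> ac_hom A2 B2"
  shows "tensor_map f g \<in> ac_hom (tensor_cone A1 A2) (tensor_cone B1 B2)"
proof -
  have "tensor_cone A1 A2 \<subseteq> blinfun_apply (tensor_map f g) -` tensor_cone B1 B2"
    unfolding tensor_cone_def[of A1]
  proof (rule hull_minimal)
    show "convex_cone (blinfun_apply (tensor_map f g) -` tensor_cone B1 B2)"
      unfolding tensor_cone_def by (intro convex_cone_vimage convex_cone_convex_cone_hull)
    show "{tensor_prod c d |c d. c \<in> A1 \<and> d \<in> A2} \<subseteq> blinfun_apply (tensor_map f g) -` tensor_cone B1 B2"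
    proof (rule subsetI)
      fix x assume "x \<in> {tensor_prod c d |c d. c \<in> A1 \<and> d \<in> A2}"
      then obtain c d where cd: "c \<in> A1" "d \<in> A2" "x = tensor_prod c d" by blast
      then have "blinfun_apply f c \<in> B1" "blinfun_apply g d \<in> B2"
        using assms by (auto simp: ac_hom_def)
      then show "x \<in> blinfun_apply (tensor_map f g) -` tensor_cone B1 B2"
        unfolding cd(3) tensor_cone_def vimage_eq tensor_map_tensor_prod by (intro hull_inc) blast
    qed
  qed
  then show ?thesis by (auto simp: ac_hom_def)
qed

text \<open>
  The closure of the image is a convex cone, so density needs to be checked on generators only. Closedness
  of the target enters because \<^const>\<open>dense_image\<close> asks for equality with the closure.
\<close>
lemma dense_image_convex_cone_hull:
  fixes F :: "'a::real_normed_vector \<Rightarrow>\<^sub>L 'b::real_normed_vector"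
  assumes "F \<in> ac_hom A (convex_cone hull S)" "convex_cone A" "closed (convex_cone hull S)"
    and "S \<subseteq> closure (blinfun_apply F ` A)"
  shows "dense_image A (convex_cone hull S) F"
proof -
  have "closure (blinfun_apply F ` A) \<subseteq> convex_cone hull S"
    using assms(1,3) by (intro closure_minimal) (auto simp: ac_hom_def)
  moreover have "convex_cone hull S \<subseteq> closure (blinfun_apply F ` A)"
    using assms(2,4) by (intro hull_minimal convex_cone_closure convex_cone_linear_image)
      (auto intro: bounded_linear.linear[OF blinfun.bounded_linear_right])
  ultimately show ?thesis using assms(1) by (auto simp: dense_image_def)
qed

lemma closure_limit:
  fixes u :: "nat \<Rightarrow> 'a::first_countable_topology"
  assumes "\<And>k. u k \<in> S" "u \<longlonglongrightarrow> l"
  shows "l \<in> closure S"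
  unfolding closure_sequential using assms by blast

lemma closure_image_sequence:
  fixes f :: "'a \<Rightarrow> 'b::first_countable_topology"
  assumes "y \<in> closure (f ` A)"
  obtains a :: "nat \<Rightarrow> 'a" where "\<And>k. a k \<in> A" "(\<lambda>k. f (a k)) \<longlonglongrightarrow> y"
proof -
  obtain z where z: "\<And>k. z k \<in> f ` A" "z \<longlonglongrightarrow> y"
    using assms unfolding closure_sequential by blast
  then obtain a where a: "\<And>k. a k \<in> A" "\<And>k. z k = f (a k)"
    unfolding image_iff by metis
  have "z = (\<lambda>k. f (a k))" using a(2) by (rule ext)
  then show ?thesis using that a(1) z(2) by blast
qed

lemma dense_image_sym_map:
  assumes B: "ac_object B" and f: "dense_image A B f"
  shows "dense_image (sym_cone A :: ('n::finite, 'a::real_normed_vector) sym_power set)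
    (sym_cone B) (sym_map f)"
proof -
  have f': "f \<in> ac_hom A B" "closure (blinfun_apply f ` A) = B"
    using f by (auto simp: dense_image_def)
  have "sym_prod v \<in> closure (blinfun_apply (sym_map f) ` sym_cone A)" if v: "\<forall>i. v i \<in> B" for v :: "'n \<Rightarrow> _"
  proof -
    have "\<forall>i. \<exists>a. (\<forall>k. a k \<in> A) \<and> (\<lambda>k. blinfun_apply f (a k)) \<longlonglongrightarrow> v i"
      using v closure_image_sequence[of _ "blinfun_apply f" A] f'(2) by metis
    then obtain a where a: "\<And>i k. a i k \<in> A" "\<And>i. (\<lambda>k. blinfun_apply f (a i k)) \<longlonglongrightarrow> v i"
      by metis
    have "(\<lambda>k. sym_prod (\<lambda>i. blinfun_apply f (a i k))) \<longlonglongrightarrow> sym_prod v"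
      by (rule tendsto_sym_prod) (rule a(2))
    moreover have "sym_prod (\<lambda>i. blinfun_apply f (a i k)) \<in> blinfun_apply (sym_map f) ` sym_cone A" for k
      unfolding sym_map_sym_prod[symmetric] sym_cone_def using a(1)
      by (intro imageI hull_inc) blast
    ultimately show ?thesis by (rule closure_limit[rotated])
  qed
  then show ?thesis
    using sym_map_ac_hom[OF f'(1)] closed_sym_cone[OF B]
    unfolding sym_cone_def[of B]
    by (intro dense_image_convex_cone_hull) (auto simp: sym_cone_def[of A] convex_cone_convex_cone_hull)
qed

lemma dense_image_tensor_map:
  assumes B: "ac_object B1" "ac_object B2" and f: "dense_image A1 B1 f" and g: "dense_image A2 B2 g"
  shows "dense_image (tensor_cone A1 A2) (tensor_cone B1 B2) (tensor_map f g)"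
proof -
  have f': "f \<in> ac_hom A1 B1" "closure (blinfun_apply f ` A1) = B1"
    using f by (auto simp: dense_image_def)
  have g': "g \<in> ac_hom A2 B2" "closure (blinfun_apply g ` A2) = B2"
    using g by (auto simp: dense_image_def)
  have "tensor_prod c d \<in> closure (blinfun_apply (tensor_map f g) ` tensor_cone A1 A2)"
    if cd: "c \<in> B1" "d \<in> B2" for c d
  proof -
    obtain a where a: "\<And>k. a k \<in> A1" "(\<lambda>k. blinfun_apply f (a k)) \<longlonglongrightarrow> c"
      using closure_image_sequence[of c "blinfun_apply f" A1] f'(2) cd(1) by metis
    obtain b where b: "\<And>k. b k \<in> A2" "(\<lambda>k. blinfun_apply g (b k)) \<longlonglongrightarrow> d"
      using closure_image_sequence[of d "blinfun_apply g" A2] g'(2) cd(2) by metis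
    have "(\<lambda>k. tensor_prod (blinfun_apply f (a k)) (blinfun_apply g (b k))) \<longlonglongrightarrow> tensor_prod c d"
      by (rule bounded_bilinear.tendsto[OF bounded_bilinear_tensor_prod a(2) b(2)])
    moreover have "tensor_prod (blinfun_apply f (a k)) (blinfun_apply g (b k))
        \<in> blinfun_apply (tensor_map f g) ` tensor_cone A1 A2" for k
      unfolding tensor_map_tensor_prod[symmetric] tensor_cone_def using a(1) b(1)
      by (intro imageI hull_inc) blast
    ultimately show ?thesis by (rule closure_limit[rotated])
  qed
  then show ?thesis
    using tensor_map_ac_hom[OF f'(1) g'(1)] closed_tensor_cone[OF B]
    unfolding tensor_cone_def[of B1]
    by (intro dense_image_convex_cone_hull) (auto simp: tensor_cone_def[of A1] convex_cone_convex_cone_hull)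
qed

section \<open>Strong injectivity and duality\<close>

lemma strongly_injectiveI:
  assumes "inj (blinfun_apply f)" "\<And>x. blinfun_apply f x \<in> D \<longleftrightarrow> x \<in> C"
  shows "strongly_injective C D f"
proof -
  have "blinfun_apply f -` D = C" using assms(2) by (auto simp: vimage_def)
  then show ?thesis using assms(1) unfolding strongly_injective_def ac_hom_def by blast
qed

text \<open>
  A continuous map that sends a dense subset into a closed cone sends everything into it. With
  \<open>C = {0}\<close> this also yields injectivity of pre-composition.
\<close>
lemma ac_hom_precomp_iff:
  assumes "closure (blinfun_apply f ` A) = B" "closed C"
  shows "g o\<^sub>L f \<in> ac_hom A C \<longleftrightarrow> g \<in> ac_hom B C"
proof
  assume "g o\<^sub>L f \<in> ac_hom A C"
  then have "blinfun_apply g ` blinfun_apply f ` A \<subseteq> C" by (auto simp: ac_hom_def)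
  then have "blinfun_apply g ` closure (blinfun_apply f ` A) \<subseteq> C"
    by (rule image_closure_subset[OF linear_continuous_on[OF blinfun.bounded_linear_right] assms(2)])
  then show "g \<in> ac_hom B C" by (simp add: ac_hom_def assms(1))
next
  assume "g \<in> ac_hom B C"
  then show "g o\<^sub>L f \<in> ac_hom A C"
    using closure_subset[of "blinfun_apply f ` A"] by (auto simp: ac_hom_def assms(1))
qed

lemma strongly_injective_precomp:
  fixes f :: "'a::real_normed_vector \<Rightarrow>\<^sub>L 'b::real_normed_vector" and C :: "'c::real_normed_vector set"
  assumes f: "dense_image A B f" and B: "span B = UNIV" and C: "closed C"
  shows "strongly_injective (ac_hom B C) (ac_hom A C) (precomp f)"
proof -
  have cl: "closure (blinfun_apply f ` A) = B" using f by (simp add: dense_image_def)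
  have "inj (blinfun_apply (precomp f :: ('b \<Rightarrow>\<^sub>L 'c) \<Rightarrow>\<^sub>L _))"
  proof (rule injI)
    fix u v :: "'b \<Rightarrow>\<^sub>L 'c"
    assume "blinfun_apply (precomp f) u = blinfun_apply (precomp f) v"
    then have eq: "u o\<^sub>L f = v o\<^sub>L f" by simp
    have "(u - v) o\<^sub>L f = 0"
    proof (rule blinfun_eqI)
      fix x
      have "blinfun_apply (u o\<^sub>L f) x = blinfun_apply (v o\<^sub>L f) x" by (simp only: eq)
      then show "blinfun_apply ((u - v) o\<^sub>L f) x = blinfun_apply 0 x"
        by (simp add: blinfun.diff_left)
    qed
    then have "(u - v) o\<^sub>L f \<in> ac_hom A {0}" by (auto simp: ac_hom_def)
    then have "u - v \<in> ac_hom B {0}" by (simp add: ac_hom_precomp_iff[OF cl])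
    then have zero: "blinfun_apply (u - v) y = 0" if "y \<in> B" for y
      using that by (auto simp: ac_hom_def image_subset_iff)
    have "blinfun_apply (u - v) x = 0" for x
    proof -
      have "x \<in> span B" unfolding B by (rule UNIV_I)
      then show ?thesis
        using linear_eq_0_on_span[OF bounded_linear.linear[OF blinfun.bounded_linear_right] zero]
        by blast
    qed
    then have "u - v = 0" by (intro blinfun_eqI) simp
    then show "u = v" by simp
  qed
  then show ?thesis
    by (rule strongly_injectiveI) (simp add: ac_hom_precomp_iff[OF cl C])
qed

lemma strongly_injective_postcomp:
  fixes h :: "'a::real_normed_vector \<Rightarrow>\<^sub>L 'b::real_normed_vector" and C :: "'c::real_normed_vector set"
  assumes "strongly_injective A B h"
  shows "strongly_injective (ac_hom C A) (ac_hom C B) (postcomp h)"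
proof -
  have inj: "inj (blinfun_apply h)" using assms unfolding strongly_injective_def by blast
  have "inj (blinfun_apply (postcomp h :: ('c \<Rightarrow>\<^sub>L _) \<Rightarrow>\<^sub>L _))"
  proof (rule injI, rule blinfun_eqI)
    fix u v :: "'c \<Rightarrow>\<^sub>L 'a" and x
    assume "blinfun_apply (postcomp h) u = blinfun_apply (postcomp h) v"
    then have "h o\<^sub>L u = h o\<^sub>L v" by simp
    then have "blinfun_apply (h o\<^sub>L u) x = blinfun_apply (h o\<^sub>L v) x" by (simp only:)
    then have "blinfun_apply h (blinfun_apply u x) = blinfun_apply h (blinfun_apply v x)" by simp
    then show "blinfun_apply u x = blinfun_apply v x" by (rule injD[OF inj])
  qed
  moreover have "blinfun_apply h x \<in> B \<longleftrightarrow> x \<in> A" for x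
    using assms unfolding strongly_injective_def by blast
  ultimately show ?thesis
    by (intro strongly_injectiveI) (auto simp: ac_hom_def image_subset_iff)
qed

lemma dual_cone_eq_ac_hom: "dual_cone C = ac_hom C {0..}"
  by (auto simp: dual_cone_def ac_hom_def)

text \<open>
  The dual of a pointed cone is full-dimensional: a functional \<open>\<phi>\<close> positive on
  \<open>C - {0}\<close> is bounded below by a multiple of the norm on \<open>C\<close>, so a large multiple
  \<open>\<eta>\<close> of it dominates any given \<open>\<psi>\<close>, and
  \<open>\<psi> = (\<eta> + \<psi>) - \<eta>\<close> is a difference of elements of the dual cone.
\<close>
lemma span_dual_cone:
  fixes C :: "'a::real_normed_vector set"
  assumes C: "ac_object C"
  shows "span (dual_cone C) = UNIV"
proof -
  obtain \<phi> :: "'a \<Rightarrow>\<^sub>L real" where \<phi>: "\<And>x. x \<in> C \<Longrightarrow> x \<noteq> 0 \<Longrightarrow> 0 < blinfun_apply \<phi> x"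
    using ac_object_pointed[OF C] by blast
  have pos: "0 < blinfun_apply \<phi> x" if "x \<in> C \<inter> sphere 0 1" for x
    using that by (intro \<phi>) auto
  obtain \<delta> where \<delta>: "0 < \<delta>" "\<And>x. x \<in> C \<inter> sphere 0 1 \<Longrightarrow> \<delta> \<le> blinfun_apply \<phi> x"
    using compact_gauge_bound[OF ac_object_compact_sphere[OF C]
        linear_continuous_on[OF blinfun.bounded_linear_right] pos] by blast
  have ge: "\<delta> * norm x \<le> blinfun_apply \<phi> x" if "x \<in> C" for x
  proof (cases "x = 0")
    case False
    then show ?thesis
      using \<delta>(2)[OF ac_object_normalize[OF C that False]]
      by (simp add: blinfun.scaleR_right field_simps)
  qed simp
  have "\<psi> \<in> span (dual_cone C)" for \<psi>
  proof -
    define \<eta> where "\<eta> = (norm \<psi> / \<delta>) *\<^sub>R \<phi>"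
    have \<eta>: "norm \<psi> * norm x \<le> blinfun_apply \<eta> x" if "x \<in> C" for x
      using mult_left_mono[OF ge[OF that], of "norm \<psi> / \<delta>"] \<delta>(1)
      by (simp add: \<eta>_def blinfun.scaleR_left)
    have "\<eta> \<in> dual_cone C"
      unfolding dual_cone_def
    proof safe
      fix x assume "x \<in> C"
      have "0 \<le> norm \<psi> * norm x" by simp
      then show "0 \<le> blinfun_apply \<eta> x" using \<eta>[OF \<open>x \<in> C\<close>] by linarith
    qed
    moreover have "\<eta> + \<psi> \<in> dual_cone C"
      unfolding dual_cone_def
    proof safe
      fix x assume "x \<in> C"
      show "0 \<le> blinfun_apply (\<eta> + \<psi>) x"
        using \<eta>[OF \<open>x \<in> C\<close>] norm_blinfun[of \<psi> x] by (simp add: blinfun.add_left)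
    qed
    ultimately have "(\<eta> + \<psi>) - \<eta> \<in> span (dual_cone C)"
      by (intro span_diff span_base)
    then show ?thesis by simp
  qed
  then show ?thesis by (intro equalityI subset_UNIV subsetI)
qed

lemma finite_dim_left_inverse:
  fixes h :: "'a::real_normed_vector \<Rightarrow>\<^sub>L 'b::real_normed_vector"
  assumes "finite_dim (UNIV :: 'b set)" "inj (blinfun_apply h)"
  obtains r :: "'b \<Rightarrow>\<^sub>L 'a" where "\<And>x. blinfun_apply r (blinfun_apply h x) = x"
proof -
  obtain g where g: "linear g" "g \<circ> blinfun_apply h = id"
    using linear_injective_left_inverse[OF bounded_linear.linear[OF blinfun.bounded_linear_right] assms(2)]
    by blast
  have "bounded_linear g" by (rule finite_dim_linear_bounded[OF assms(1) g(1)])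
  then show ?thesis
    by (intro that[of "Blinfun g"]) (simp add: bounded_linear_Blinfun_apply pointfree_idE[OF g(2)])
qed

text \<open>
  A left inverse of \<open>h\<close> induces a left inverse of \<open>Sym\<^sup>n(h)\<close> by
  functoriality.
\<close>
lemma inj_sym_map:
  fixes h :: "'a::real_normed_vector \<Rightarrow>\<^sub>L 'b::real_normed_vector"
  assumes "finite_dim (UNIV :: 'b set)" "inj (blinfun_apply h)"
  shows "inj (blinfun_apply (sym_map h :: ('n::finite, 'a) sym_power \<Rightarrow>\<^sub>L _))"
proof -
  obtain r where r: "\<And>x. blinfun_apply r (blinfun_apply h x) = x"
    using finite_dim_left_inverse[OF assms] by blast
  have "blinfun_apply (sym_map r) (blinfun_apply (sym_map h) x) = x" for x :: "('n, 'a) sym_power"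
  proof (rule blinfun_eqI)
    fix m :: "('n, 'a) sym_form"
    have "sym_form_pullback h (sym_form_pullback r m) = m"
      by (rule sym_form_eqI) (simp add: sym_form_pullback.rep_eq r)
    then show "blinfun_apply (blinfun_apply (sym_map r) (blinfun_apply (sym_map h) x)) m =
        blinfun_apply x m"
      by (simp add: sym_map_apply)
  qed
  then show ?thesis by (rule inj_on_inverseI)
qed

lemma inj_tensor_map:
  fixes h :: "'a1::real_normed_vector \<Rightarrow>\<^sub>L 'b1::real_normed_vector"
    and t :: "'a2::real_normed_vector \<Rightarrow>\<^sub>L 'b2::real_normed_vector"
  assumes "finite_dim (UNIV :: 'b1 set)" "inj (blinfun_apply h)"
    and "finite_dim (UNIV :: 'b2 set)" "inj (blinfun_apply t)"
  shows "inj (blinfun_apply (tensor_map h t))"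
proof -
  obtain r where r: "\<And>x. blinfun_apply r (blinfun_apply h x) = x"
    using finite_dim_left_inverse[OF assms(1,2)] by blast
  obtain s where s: "\<And>x. blinfun_apply s (blinfun_apply t x) = x"
    using finite_dim_left_inverse[OF assms(3,4)] by blast
  have "blinfun_apply (tensor_map r s) (blinfun_apply (tensor_map h t) x) = x" for x
  proof (rule blinfun_eqI)
    fix b :: "'a1 \<Rightarrow>\<^sub>L 'a2 \<Rightarrow>\<^sub>L real"
    have "transpose_map t o\<^sub>L ((transpose_map s o\<^sub>L (b o\<^sub>L r)) o\<^sub>L h) = b"
      by (intro blinfun_eqI) (simp add: r s)
    then show "blinfun_apply (blinfun_apply (tensor_map r s) (blinfun_apply (tensor_map h t) x)) b =
        blinfun_apply x b"
      by (simp add: tensor_map_apply)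
  qed
  then show ?thesis by (rule inj_on_inverseI)
qed

lemma closed_dual_cone: "closed (dual_cone (C :: 'a::real_normed_vector set))"
proof -
  have "dual_cone C = (\<Inter>x\<in>C. {\<phi>. 0 \<le> blinfun_apply \<phi> x})"
    by (auto simp: dual_cone_def)
  moreover have "closed {\<phi> :: 'a \<Rightarrow>\<^sub>L real. 0 \<le> blinfun_apply \<phi> x}" for x
    by (intro closed_Collect_le continuous_intros)
  ultimately show ?thesis by (simp add: closed_INT)
qed

lemma convex_cone_dual_cone: "convex_cone (dual_cone C)"
  by (auto simp: convex_cone_iff dual_cone_def blinfun.bilinear_simps)

text \<open>
  The bipolar argument that turns statements about strongly injective maps into statements about dense
  images. A functional \<open>\<phi>\<close> in \<open>A\<^sup>*\<close> outside the closure of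
  \<open>h\<^sup>* B\<^sup>*\<close> would be separated from it by an element of the double dual, that is,
  by evaluation at some vector \<open>x\<close>. Then every element of \<open>B\<^sup>*\<close> is
  nonnegative at \<open>h x\<close>, so \<open>h x\<close> lies in the closed cone \<open>B\<close>, again
  by separation; strong injectivity gives \<open>x \<in> A\<close>, and \<open>\<phi> x \<ge> 0\<close>
  contradicts the choice of \<open>x\<close>.
\<close>
lemma dense_image_transpose:
  fixes h :: "'a::real_normed_vector \<Rightarrow>\<^sub>L 'b::real_normed_vector"
  assumes A: "ac_object A" and B: "ac_object B" and h: "strongly_injective A B h"
  shows "dense_image (dual_cone B) (dual_cone A) (transpose_map h)"
proof -
  have h_iff: "blinfun_apply h x \<in> B \<longleftrightarrow> x \<in> A" for x
    using h unfolding strongly_injective_def by blast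
  have hom: "transpose_map h \<in> ac_hom (dual_cone B) (dual_cone A)"
    using h_iff by (auto simp: ac_hom_def dual_cone_def)
  let ?I = "blinfun_apply (transpose_map h) ` dual_cone B"
  have cone: "convex_cone (closure ?I)"
    by (intro convex_cone_closure convex_cone_linear_image conjI convex_cone_dual_cone
        bounded_linear.linear[OF blinfun.bounded_linear_right])
  have "\<phi> \<in> closure ?I" if \<phi>: "\<phi> \<in> dual_cone A" for \<phi>
  proof (rule ccontr)
    assume notin: "\<phi> \<notin> closure ?I"
    have fd: "finite_dim (UNIV :: ('a \<Rightarrow>\<^sub>L real) set)"
      by (intro finite_dim_blinfun finite_dim_real ac_object_finite_dim[OF A])
    obtain \<psi> :: "('a \<Rightarrow>\<^sub>L real) \<Rightarrow>\<^sub>L real" where \<psi>: "\<forall>\<eta>\<in>closure ?I. 0 \<le> blinfun_apply \<psi> \<eta>"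
      "blinfun_apply \<psi> \<phi> < 0"
      by (rule closed_convex_cone_separation[OF fd cone closed_closure notin])
    obtain x where x: "\<And>\<eta>. blinfun_apply \<psi> \<eta> = blinfun_apply \<eta> x"
      using finite_dim_double_dual[OF ac_object_finite_dim[OF A]] by blast
    have "blinfun_apply h x \<in> B"
    proof (rule ccontr)
      assume hx: "blinfun_apply h x \<notin> B"
      obtain \<beta> :: "'b \<Rightarrow>\<^sub>L real" where \<beta>: "\<forall>y\<in>B. 0 \<le> blinfun_apply \<beta> y"
        "blinfun_apply \<beta> (blinfun_apply h x) < 0"
        by (rule closed_convex_cone_separation[OF ac_object_finite_dim[OF B] ac_object_convex_cone[OF B]
            ac_object_closed[OF B] hx])
      have "\<beta> \<in> dual_cone B" using \<beta>(1) by (simp add: dual_cone_def)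
      from subsetD[OF closure_subset imageI[OF this, of "blinfun_apply (transpose_map h)"]]
      have "\<beta> o\<^sub>L h \<in> closure ?I" by simp
      from bspec[OF \<psi>(1) this] show False using \<beta>(2) by (simp add: x)
    qed
    then have "0 \<le> blinfun_apply \<phi> x" using \<phi> by (simp add: h_iff dual_cone_def)
    then show False using \<psi>(2) by (simp add: x)
  qed
  then have "dual_cone A \<subseteq> closure ?I" by (rule subsetI)
  moreover have "closure ?I \<subseteq> dual_cone A"
    using hom by (intro closure_minimal closed_dual_cone) (simp only: ac_hom_def mem_Collect_eq)
  ultimately show ?thesis unfolding dense_image_def by (intro conjI hom equalityI)
qed

section \<open>The dual cones of tensor and symmetric cones of duals\<close>

lemma dual_cone_hull: "\<phi> \<in> dual_cone (convex_cone hull S) \<longleftrightarrow> (\<forall>s\<in>S. 0 \<le> blinfun_apply \<phi> s)"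
proof
  assume "\<phi> \<in> dual_cone (convex_cone hull S)"
  then show "\<forall>s\<in>S. 0 \<le> blinfun_apply \<phi> s" by (auto simp: dual_cone_def hull_inc)
next
  assume S: "\<forall>s\<in>S. 0 \<le> blinfun_apply \<phi> s"
  have "convex_cone {x. 0 \<le> blinfun_apply \<phi> x}"
    by (auto simp: convex_cone_iff blinfun.bilinear_simps)
  then have "convex_cone hull S \<subseteq> {x. 0 \<le> blinfun_apply \<phi> x}"
    using S by (intro hull_minimal) auto
  then show "\<phi> \<in> dual_cone (convex_cone hull S)" by (auto simp: dual_cone_def)
qed

lemma sym_ident_apply_sym_prod:
  "blinfun_apply (sym_ident x) (sym_prod \<phi>) = blinfun_apply x (covector_sym_prod \<phi>)"
proof -
  have "blinfun_apply (sym_ident x) (sym_prod \<phi>) =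
      sym_form_apply (Sym_form (\<lambda>\<phi>. blinfun_apply x (covector_sym_prod \<phi>))) \<phi>"
    unfolding sym_ident_def by (simp add: bounded_linear_Blinfun_apply)
  also have "\<dots> = blinfun_apply x (covector_sym_prod \<phi>)"
    by (subst Sym_form_inverse) (simp_all only: mem_Collect_eq is_sym_form_apply_covector_sym_prod)
  finally show ?thesis .
qed

text \<open>
  Membership in \<open>Sym\<^sup>n(D)\<^sup>*\<close>, for a cone \<open>D\<close> of functionals, is tested
  on products of elements of \<open>D\<close>, and there the canonical identification becomes evaluation at
  symmetric forms.
\<close>
lemma sym_bidual_iff:
  "x \<in> sym_ident -` dual_cone (sym_cone D) \<longleftrightarrow>
     (\<forall>\<phi>. (\<forall>i. \<phi> i \<in> D) \<longrightarrow> 0 \<le> blinfun_apply x (covector_sym_prod \<phi>))"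
  unfolding sym_cone_def vimage_eq dual_cone_hull sym_ident_apply_sym_prod[symmetric] by blast

lemma tensor_ident_apply_tensor_prod:
  "blinfun_apply (tensor_ident x) (tensor_prod \<phi> \<psi>) = blinfun_apply x (covector_prod \<phi> \<psi>)"
  using bilinear_form_apply[OF bounded_bilinear_apply_covector_prod[of x], of \<phi> \<psi>]
  by (simp add: tensor_ident_apply)

lemma tensor_bidual_iff:
  "x \<in> tensor_ident -` dual_cone (tensor_cone D1 D2) \<longleftrightarrow>
     (\<forall>\<phi>\<in>D1. \<forall>\<psi>\<in>D2. 0 \<le> blinfun_apply x (covector_prod \<phi> \<psi>))"
  unfolding tensor_cone_def vimage_eq dual_cone_hull tensor_ident_apply_tensor_prod[symmetric]
  by blast

lemma sym_cone_subset_bidual: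
  fixes C :: "'a::real_normed_vector set"
  shows "(sym_cone C :: ('n::finite, 'a) sym_power set) \<subseteq> sym_ident -` dual_cone (sym_cone (dual_cone C))"
proof
  fix x :: "('n, 'a) sym_power" assume x: "x \<in> sym_cone C"
  have "0 \<le> blinfun_apply x (covector_sym_prod \<phi>)" if \<phi>: "\<forall>i. \<phi> i \<in> dual_cone C"
    for \<phi> :: "'n \<Rightarrow> 'a \<Rightarrow>\<^sub>L real"
  proof -
    let ?H = "{x :: ('n, 'a) sym_power. 0 \<le> blinfun_apply x (covector_sym_prod \<phi>)}"
    have "convex_cone ?H" by (auto simp: convex_cone_iff blinfun.bilinear_simps)
    moreover have "{sym_prod v | v. \<forall>i. v i \<in> C} \<subseteq> ?H"
      using \<phi> by (auto simp: covector_sym_prod.rep_eq dual_cone_def intro!: sym_pairing_nonneg)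
    ultimately have "sym_cone C \<subseteq> ?H" unfolding sym_cone_def by (intro hull_minimal)
    then show ?thesis using x by auto
  qed
  then show "x \<in> sym_ident -` dual_cone (sym_cone (dual_cone C))" by (simp only: sym_bidual_iff) blast
qed

lemma tensor_cone_subset_bidual:
  fixes C :: "'a::real_normed_vector set" and D :: "'b::real_normed_vector set"
  shows "tensor_cone C D \<subseteq> tensor_ident -` dual_cone (tensor_cone (dual_cone C) (dual_cone D))"
proof
  fix x :: "('a, 'b) tensor" assume x: "x \<in> tensor_cone C D"
  have "0 \<le> blinfun_apply x (covector_prod \<phi> \<psi>)" if "\<phi> \<in> dual_cone C" "\<psi> \<in> dual_cone D" for \<phi> \<psi>
  proof -
    let ?H = "{x :: ('a, 'b) tensor. 0 \<le> blinfun_apply x (covector_prod \<phi> \<psi>)}"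
    have "convex_cone ?H" by (auto simp: convex_cone_iff blinfun.bilinear_simps)
    moreover have "{tensor_prod c d | c d. c \<in> C \<and> d \<in> D} \<subseteq> ?H"
      using that by (auto simp: dual_cone_def)
    ultimately have "tensor_cone C D \<subseteq> ?H" unfolding tensor_cone_def by (intro hull_minimal)
    then show ?thesis using x by auto
  qed
  then show "x \<in> tensor_ident -` dual_cone (tensor_cone (dual_cone C) (dual_cone D))"
    by (simp only: tensor_bidual_iff) blast
qed

text \<open>
  Testing \<open>Sym\<^sup>n(h) x\<close> against products from \<open>D\<close> is testing \<open>x\<close>
  against products of pullbacks, and by density and joint continuity these products detect positivity on all
  products from \<open>E\<close>. Applied to \<open>D = B\<^sup>*\<close> and \<open>E = A\<^sup>*\<close>.
\<close>
lemma sym_bidual_sym_map_iff: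
  fixes h :: "'a::real_normed_vector \<Rightarrow>\<^sub>L 'b::real_normed_vector" and x :: "('n::finite, 'a) sym_power"
  assumes "dense_image D E (transpose_map h)"
  shows "blinfun_apply (sym_map h) x \<in> sym_ident -` dual_cone (sym_cone D) \<longleftrightarrow>
    x \<in> sym_ident -` dual_cone (sym_cone E)"
proof -
  have cl: "closure (blinfun_apply (transpose_map h) ` D) = E"
    using assms by (simp add: dense_image_def)
  have pull: "blinfun_apply (blinfun_apply (sym_map h) x) (covector_sym_prod \<beta>) =
      blinfun_apply x (covector_sym_prod (\<lambda>i. \<beta> i o\<^sub>L h))" for \<beta> :: "'n \<Rightarrow> _"
  proof -
    have "sym_form_pullback h (covector_sym_prod \<beta>) = covector_sym_prod (\<lambda>i. \<beta> i o\<^sub>L h)"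
      by (rule sym_form_eqI)
         (simp add: sym_form_pullback.rep_eq covector_sym_prod.rep_eq sym_pairing_def)
    then show ?thesis by (simp add: sym_map_apply)
  qed
  have "(\<forall>\<beta>. (\<forall>i. \<beta> i \<in> D) \<longrightarrow> 0 \<le> blinfun_apply x (covector_sym_prod (\<lambda>i. \<beta> i o\<^sub>L h))) \<longleftrightarrow>
        (\<forall>\<alpha>. (\<forall>i. \<alpha> i \<in> E) \<longrightarrow> 0 \<le> blinfun_apply x (covector_sym_prod \<alpha>))"
  proof (intro iffI allI impI)
    fix \<beta> :: "'n \<Rightarrow> 'b \<Rightarrow>\<^sub>L real"
    assume E: "\<forall>\<alpha>. (\<forall>i. \<alpha> i \<in> E) \<longrightarrow> 0 \<le> blinfun_apply x (covector_sym_prod \<alpha>)" and "\<forall>i. \<beta> i \<in> D"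
    have "\<beta> i o\<^sub>L h \<in> E" for i
      using assms \<open>\<forall>i. \<beta> i \<in> D\<close> by (auto simp: dense_image_def ac_hom_def)
    then show "0 \<le> blinfun_apply x (covector_sym_prod (\<lambda>i. \<beta> i o\<^sub>L h))"
      using E[rule_format, of "\<lambda>i. \<beta> i o\<^sub>L h"] by simp
  next
    fix \<alpha> :: "'n \<Rightarrow> 'a \<Rightarrow>\<^sub>L real"
    assume D: "\<forall>\<beta>. (\<forall>i. \<beta> i \<in> D) \<longrightarrow> 0 \<le> blinfun_apply x (covector_sym_prod (\<lambda>i. \<beta> i o\<^sub>L h))"
      and \<alpha>: "\<forall>i. \<alpha> i \<in> E"
    have "\<forall>i. \<exists>b. (\<forall>k. b k \<in> D) \<and> (\<lambda>k. b k o\<^sub>L h) \<longlonglongrightarrow> \<alpha> i"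
    proof
      fix i
      have "\<alpha> i \<in> closure (blinfun_apply (transpose_map h) ` D)" unfolding cl using \<alpha> by blast
      then show "\<exists>b. (\<forall>k. b k \<in> D) \<and> (\<lambda>k. b k o\<^sub>L h) \<longlonglongrightarrow> \<alpha> i"
        by (rule closure_image_sequence) auto
    qed
    then obtain b where b: "\<And>i k. b i k \<in> D" "\<And>i. (\<lambda>k. b i k o\<^sub>L h) \<longlonglongrightarrow> \<alpha> i" by metis
    \<comment> \<open>The test values depend on the functionals through a symmetric form on the dual space, so the convergence of products in its symmetric power applies.\<close>
    define m where "m = Sym_form (\<lambda>\<phi>. blinfun_apply x (covector_sym_prod \<phi>))"
    have m: "sym_form_apply m \<phi> = blinfun_apply x (covector_sym_prod \<phi>)" for \<phi>
      unfolding m_def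
      by (subst Sym_form_inverse) (simp_all only: mem_Collect_eq is_sym_form_apply_covector_sym_prod)
    have "(\<lambda>k. sym_prod (\<lambda>i. b i k o\<^sub>L h)) \<longlonglongrightarrow> sym_prod \<alpha>"
      by (rule tendsto_sym_prod) (rule b(2))
    then have "(\<lambda>k. blinfun_apply (sym_prod (\<lambda>i. b i k o\<^sub>L h)) m) \<longlonglongrightarrow> blinfun_apply (sym_prod \<alpha>) m"
      by (intro tendsto_intros)
    then have "(\<lambda>k. blinfun_apply x (covector_sym_prod (\<lambda>i. b i k o\<^sub>L h)))
        \<longlonglongrightarrow> blinfun_apply x (covector_sym_prod \<alpha>)"
      by (simp add: m)
    moreover have "0 \<le> blinfun_apply x (covector_sym_prod (\<lambda>i. b i k o\<^sub>L h))" for k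
      using D[rule_format, of "\<lambda>i. b i k"] b(1) by simp
    ultimately show "0 \<le> blinfun_apply x (covector_sym_prod \<alpha>)"
      by (intro LIMSEQ_le_const) auto
  qed
  then show ?thesis by (simp only: sym_bidual_iff pull)
qed

lemma tensor_bidual_tensor_map_iff:
  assumes "dense_image D1 E1 (transpose_map h)" "dense_image D2 E2 (transpose_map t)"
  shows "blinfun_apply (tensor_map h t) x \<in> tensor_ident -` dual_cone (tensor_cone D1 D2) \<longleftrightarrow>
    x \<in> tensor_ident -` dual_cone (tensor_cone E1 E2)"
proof -
  have cl: "closure (blinfun_apply (transpose_map h) ` D1) = E1"
    "closure (blinfun_apply (transpose_map t) ` D2) = E2"
    using assms by (simp_all add: dense_image_def)
  have pull: "blinfun_apply (blinfun_apply (tensor_map h t) x) (covector_prod \<beta> \<gamma>) =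
      blinfun_apply x (covector_prod (\<beta> o\<^sub>L h) (\<gamma> o\<^sub>L t))" for \<beta> \<gamma>
  proof -
    have "transpose_map t o\<^sub>L (covector_prod \<beta> \<gamma> o\<^sub>L h) = covector_prod (\<beta> o\<^sub>L h) (\<gamma> o\<^sub>L t)"
      by (intro blinfun_eqI) simp
    then show ?thesis by (simp add: tensor_map_apply)
  qed
  have "(\<forall>\<beta>\<in>D1. \<forall>\<gamma>\<in>D2. 0 \<le> blinfun_apply x (covector_prod (\<beta> o\<^sub>L h) (\<gamma> o\<^sub>L t))) \<longleftrightarrow>
        (\<forall>\<phi>\<in>E1. \<forall>\<psi>\<in>E2. 0 \<le> blinfun_apply x (covector_prod \<phi> \<psi>))"
  proof (intro iffI ballI)
    fix \<beta> \<gamma>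
    assume E: "\<forall>\<phi>\<in>E1. \<forall>\<psi>\<in>E2. 0 \<le> blinfun_apply x (covector_prod \<phi> \<psi>)"
      and "\<beta> \<in> D1" "\<gamma> \<in> D2"
    then have "\<beta> o\<^sub>L h \<in> E1" "\<gamma> o\<^sub>L t \<in> E2"
      using assms by (auto simp: dense_image_def ac_hom_def)
    then show "0 \<le> blinfun_apply x (covector_prod (\<beta> o\<^sub>L h) (\<gamma> o\<^sub>L t))" using E by blast
  next
    fix \<phi> \<psi>
    assume D: "\<forall>\<beta>\<in>D1. \<forall>\<gamma>\<in>D2. 0 \<le> blinfun_apply x (covector_prod (\<beta> o\<^sub>L h) (\<gamma> o\<^sub>L t))"
      and mem: "\<phi> \<in> E1" "\<psi> \<in> E2"
    obtain b where b: "\<And>k. b k \<in> D1" "(\<lambda>k. blinfun_apply (transpose_map h) (b k)) \<longlonglongrightarrow> \<phi>"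
      using closure_image_sequence[of \<phi> "blinfun_apply (transpose_map h)" D1] mem(1) cl(1) by blast
    obtain c where c: "\<And>k. c k \<in> D2" "(\<lambda>k. blinfun_apply (transpose_map t) (c k)) \<longlonglongrightarrow> \<psi>"
      using closure_image_sequence[of \<psi> "blinfun_apply (transpose_map t)" D2] mem(2) cl(2) by blast
    have "(\<lambda>k. blinfun_apply x (covector_prod (b k o\<^sub>L h) (c k o\<^sub>L t)))
        \<longlonglongrightarrow> blinfun_apply x (covector_prod \<phi> \<psi>)"
      using bounded_bilinear.tendsto[OF bounded_bilinear_apply_covector_prod b(2) c(2)] by simp
    moreover have "0 \<le> blinfun_apply x (covector_prod (b k o\<^sub>L h) (c k o\<^sub>L t))" for k
      using D b(1) c(1) by blast
    ultimately show "0 \<le> blinfun_apply x (covector_prod \<phi> \<psi>)"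
      by (intro LIMSEQ_le_const) auto
  qed
  then show ?thesis by (simp only: tensor_bidual_iff pull)
qed


section \<open>Dense images and strong injections\<close>

theorem theorem5p2:
  fixes A1 :: "'a1::real_normed_vector set" and A2 :: "'a2::real_normed_vector set"
    and B1 :: "'b1::real_normed_vector set" and B2 :: "'b2::real_normed_vector set"
    and C :: "'c::real_normed_vector set"
    and f h :: "'a1 \<Rightarrow>\<^sub>L 'b1" and g t :: "'a2 \<Rightarrow>\<^sub>L 'b2"
  assumes "ac_object A1" "ac_object A2" "ac_object B1" "ac_object B2" "ac_object C"
  shows
    "(dense_image A1 B1 f \<longrightarrow>
        dense_image (sym_cone A1 :: ('n::finite, 'a1) sym_power set) (sym_cone B1) (sym_map f) \<and>
        strongly_injective (ac_hom B1 C) (ac_hom A1 C) (precomp f) \<and>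
        strongly_injective (ac_hom C (dual_cone B1)) (ac_hom C (dual_cone A1))
          (postcomp (transpose_map f)) \<and>
        (dense_image A2 B2 g \<longrightarrow>
           dense_image (tensor_cone A1 A2) (tensor_cone B1 B2) (tensor_map f g)))
     \<and>
     (strongly_injective A1 B1 h \<longrightarrow>
        strongly_injective (ac_hom C A1) (ac_hom C B1) (postcomp h) \<and>
        strongly_injective (ac_hom (dual_cone A1) C) (ac_hom (dual_cone B1) C)
          (precomp (transpose_map h)) \<and>
        strongly_injective
          (sym_ident -` dual_cone (sym_cone (dual_cone A1)) :: ('n, 'a1) sym_power set)
          (sym_ident -` dual_cone (sym_cone (dual_cone B1)))
          (sym_map h) \<and>
        (sym_cone A1 :: ('n, 'a1) sym_power set)
          \<subseteq> blinfun_apply (sym_map h) -` sym_cone B1 \<and>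
        blinfun_apply (sym_map h) -` sym_cone B1
          \<subseteq> (sym_ident -` dual_cone (sym_cone (dual_cone A1)) :: ('n, 'a1) sym_power set) \<and>
        (strongly_injective A2 B2 t \<longrightarrow>
           strongly_injective
             (tensor_ident -` dual_cone (tensor_cone (dual_cone A1) (dual_cone A2)))
             (tensor_ident -` dual_cone (tensor_cone (dual_cone B1) (dual_cone B2)))
             (tensor_map h t) \<and>
           tensor_cone A1 A2 \<subseteq> blinfun_apply (tensor_map h t) -` tensor_cone B1 B2 \<and>
           blinfun_apply (tensor_map h t) -` tensor_cone B1 B2
             \<subseteq> tensor_ident -` dual_cone (tensor_cone (dual_cone A1) (dual_cone A2))))"
proof (intro conjI impI)
  note fd = ac_object_finite_dim[OF assms(1)] ac_object_finite_dim[OF assms(2)]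
    ac_object_finite_dim[OF assms(3)] ac_object_finite_dim[OF assms(4)]
  {
    assume f: "dense_image A1 B1 f"
    note B1 = ac_object_span[OF assms(3)]
    show "dense_image (sym_cone A1 :: ('n, 'a1) sym_power set) (sym_cone B1) (sym_map f)"
      by (rule dense_image_sym_map[OF assms(3) f])
    show "strongly_injective (ac_hom B1 C) (ac_hom A1 C) (precomp f)"
      by (rule strongly_injective_precomp[OF f B1 ac_object_closed[OF assms(5)]])
    have "strongly_injective (dual_cone B1) (dual_cone A1) (transpose_map f)"
      unfolding dual_cone_eq_ac_hom by (rule strongly_injective_precomp[OF f B1 closed_atLeast])
    then show "strongly_injective (ac_hom C (dual_cone B1)) (ac_hom C (dual_cone A1))
        (postcomp (transpose_map f))"
      by (rule strongly_injective_postcomp)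
    show "dense_image (tensor_cone A1 A2) (tensor_cone B1 B2) (tensor_map f g)"
      if "dense_image A2 B2 g"
      by (rule dense_image_tensor_map[OF assms(3,4) f that])
  }
  {
    assume h: "strongly_injective A1 B1 h"
    have hom: "h \<in> ac_hom A1 B1" and inj: "inj (blinfun_apply h)"
      using h unfolding strongly_injective_def by blast+
    note dense = dense_image_transpose[OF assms(1,3) h]
    show "strongly_injective (ac_hom C A1) (ac_hom C B1) (postcomp h)"
      by (rule strongly_injective_postcomp[OF h])
    show "strongly_injective (ac_hom (dual_cone A1) C) (ac_hom (dual_cone B1) C)
        (precomp (transpose_map h))"
      by (rule strongly_injective_precomp[OF dense span_dual_cone[OF assms(1)]
            ac_object_closed[OF assms(5)]])
    show "strongly_injective
        (sym_ident -` dual_cone (sym_cone (dual_cone A1)) :: ('n, 'a1) sym_power set)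
        (sym_ident -` dual_cone (sym_cone (dual_cone B1))) (sym_map h)"
      by (rule strongly_injectiveI[OF inj_sym_map[OF fd(3) inj] sym_bidual_sym_map_iff[OF dense]])
    show "(sym_cone A1 :: ('n, 'a1) sym_power set) \<subseteq> blinfun_apply (sym_map h) -` sym_cone B1"
      using sym_map_ac_hom[OF hom] unfolding ac_hom_def by blast
    show "blinfun_apply (sym_map h) -` sym_cone B1
        \<subseteq> (sym_ident -` dual_cone (sym_cone (dual_cone A1)) :: ('n, 'a1) sym_power set)"
      using sym_cone_subset_bidual[of B1] sym_bidual_sym_map_iff[OF dense] by blast
    assume t: "strongly_injective A2 B2 t"
    have hom': "t \<in> ac_hom A2 B2" and inj': "inj (blinfun_apply t)"
      using t unfolding strongly_injective_def by blast+
    note dense' = dense_image_transpose[OF assms(2,4) t]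
    show "strongly_injective
        (tensor_ident -` dual_cone (tensor_cone (dual_cone A1) (dual_cone A2)))
        (tensor_ident -` dual_cone (tensor_cone (dual_cone B1) (dual_cone B2))) (tensor_map h t)"
      by (rule strongly_injectiveI[OF inj_tensor_map[OF fd(3) inj fd(4) inj']
            tensor_bidual_tensor_map_iff[OF dense dense']])
    show "tensor_cone A1 A2 \<subseteq> blinfun_apply (tensor_map h t) -` tensor_cone B1 B2"
      using tensor_map_ac_hom[OF hom hom'] unfolding ac_hom_def by blast
    show "blinfun_apply (tensor_map h t) -` tensor_cone B1 B2
        \<subseteq> tensor_ident -` dual_cone (tensor_cone (dual_cone A1) (dual_cone A2))"
      using tensor_cone_subset_bidual[of B1 B2] tensor_bidual_tensor_map_iff[OF dense dense']
      by blast
  }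
qed

end
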